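(* Suppose the perturbations are intermittent (as defined in the context) and zero-mean, i.e. $\mathbb{E}_t^{\mathcal{G}_i}[\delta_i^{(t)}]=0$ and $\mathbb{E}_t^{\mathcal{H}_{i+1}}[\varepsilon_{i+1}^{(t)}]=0$ for all $t=0,1,\ldots,T-1$ and $i=1,2,\ldots,N-1$. Then, under the loss smoothness, stochasticity and operator regularity assumptions (stated in the context), perturbed SGD (with suitably chosen step size) achieves a convergence rate of $\mathcal{O}(T^{-1/2})$ provided that $Q_\delta\lesssim T^{1/2}$ and $Q_\varepsilon\lesssim T$. That is, for every $c>0$ there exist $K>0$, $T_0$ and step sizes $\gamma=\gamma_T>0$ such that for all $T\ge T_0$, whenever the perturbations have magnitude at most $c$ and $Q_\delta\le cT^{1/2}$, $Q_\varepsilon\le cT$, one has $\frac1T\sum_{t=0}^{T-1}\mathbb{E}[\|\nabla\ell(\boldsymbol{w}^{(t)})\|^2]\le K\,T^{-1/2}$.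
   Context: Setting. Let $N\ge 2$, let $d_0,\ldots,d_{N-1},d_{w_1},\ldots,d_{w_N}$ be positive integers and $d_N=1$. For $i=1,\ldots,N$ let $f_i:\mathbb{R}^{d_{i-1}}\times\mathbb{R}^{d_{w_i}}\to\mathbb{R}^{d_i}$ be twice differentiable operators, and let $\mathcal{R}:\mathbb{R}^d\to\mathbb{R}$ be differentiable, where $\boldsymbol{w}=(w_1^\top,\ldots,w_N^\top)^\top\in\mathbb{R}^d$, $d=\sum_i d_{w_i}$. For $x\in\mathbb{R}^{d_0}$ put $y_0=x$, $y_i=f_i(y_{i-1},w_i)$, $\mathcal{F}(x;\boldsymbol{w})=y_N$, $\mathcal{L}(x;\boldsymbol{w})=\mathcal{F}(x;\boldsymbol{w})+\mathcal{R}(\boldsymbol{w})$, and $\ell(\boldsymbol{w})=\mathbb{E}_{x\sim\mathcal{D}}[\mathcal{L}(x;\boldsymbol{w})]$ for a data distribution $\mathcal{D}$. The minimum $\ell^*=\min_{\boldsymbol{w}}\ell(\boldsymbol{w})$ exists; the initial point $\boldsymbol{w}^{(0)}$ is fixed. $\nabla_1 f_i$ and $\nabla_2 f_i$ denote the Jacobians of $f_i$ with respect to $y_{i-1}$ and $w_i$, and $\nabla^2_{21}f_i\in\mathbb{R}^{d_i\times d_{w_i}\times d_{i-1}}$ is the derivative of $\nabla_2 f_i$ with respect to $y_{i-1}$. Norms. $\|\cdot\|$ is the Euclidean norm for vectors and the Frobenius norm for matrices and tensors; $\|\cdot\|_{\mathrm{op}}$ is the induced operator norm. For $\mathcal{H}\in\mathbb{R}^{p\times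 m\times n}$ and $A\in\mathbb{R}^{m\times n}$, $[\mathcal{H}(A)]_j=\sum_{\alpha,\beta}\mathcal{H}_{j\alpha\beta}A_{\alpha\beta}$ and $\|\mathcal{H}\|_{\mathrm{op}}=\sup_{\|A\|=1}\|\mathcal{H}(A)\|$. Perturbed SGD. For a horizon $T$ and constant step size $\gamma>0$, at iteration $t=0,\ldots,T-1$, with current weights $\boldsymbol{w}^{(t)}$, data sample $x^{(t)}\sim\mathcal{D}$, and random perturbations $\delta_i^{(t)}$ (forward) and $\varepsilon_i^{(t)}$ (backward): $\tilde y_0^{(t)}=x^{(t)}$, $\tilde y_i^{(t)}=f_i(\tilde y_{i-1}^{(t)},w_i^{(t)})+\delta_i^{(t)}$ for $i=1,\ldots,N$; $\tilde v_N^{(t)}=1$, $\tilde v_{i-1}^{(t)}=\nabla_1 f_i(\tilde y_{i-1}^{(t)},w_i^{(t)})^\top\tilde v_i^{(t)}+\varepsilon_i^{(t)}$ for $i=N,\ldots,2$; $\tilde u_i^{(t)}=\nabla_2 f_i(\tilde y_{i-1}^{(t)},w_i^{(t)})^\top\tilde v_i^{(t)}$ for $i=N,\ldots,1$; and $w_i^{(t+1)}=w_i^{(t)}-\gamma(\tilde u_i^{(t)}+r_i^{(t)})$ with $r_i^{(t)}=\nabla_{w_i}\mathcal{R}(\boldsymbol{w}^{(t)})$. Intermittent perturbations. For each $t$ and $i$, either an intermittent forward perturbation occurs, in which case $\delta_i^{(t)}$ is of order $\mathcal{O}(1)$ (i.e. $\|\delta_i^{(t)}\|\le c$ for a constant $c$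 independent of $T$), or $\delta_i^{(t)}=0$; similarly for the backward perturbations $\varepsilon_i^{(t)}$. $Q_\delta$ and $Q_\varepsilon$ denote the total number of perturbation occurrences throughout the optimization (over all iterations and components) in the forward and backward passes, respectively. Filtrations. $\mathcal{F}^{(t)}$ is the filtration generated up to iteration $t$ (so $\boldsymbol{w}^{(t)}$ is $\mathcal{F}^{(t)}$-measurable, while $x^{(t)}$ is a fresh sample from $\mathcal{D}$ independent of $\mathcal{F}^{(t)}$); $\mathcal{G}_i^{(t)}=\sigma(\mathcal{F}^{(t)}\cup\{\tilde y_1^{(t)},\ldots,\tilde y_i^{(t)}\})$; $\mathcal{H}_i^{(t)}=\sigma(\mathcal{G}_N^{(t)}\cup\{\tilde v_N^{(t)},\ldots,\tilde v_i^{(t)}\})$; $\mathbb{E}_t^{\mathcal{G}_i}[\cdot]$, $\mathbb{E}_t^{\mathcal{H}_i}[\cdot]$ are the conditional expectations with respect to $\mathcal{G}_i^{(t)}$, $\mathcal{H}_i^{(t)}$. Notation. $a\lesssim b$ means $a\le cb$ for a constant $c>0$ independent of $T$. Loss smoothness assumption. There is $L_{\nabla\ell}>0$ such that $\nabla\ell$ is $L_{\nabla\ell}$-Lipschitz continuous. Stochasticity assumption. There is $\sigma>0$ such that for every $\boldsymbol{w}\in\mathbb{R}^d$, $\mathbb{E}_{x\sim\mathcal{D}}[\nabla_{\boldsymbol{w}}\mathcal{L}(x;\boldsymbol{w})]=\nabla\ell(\boldsymbol{w})$ and $\mathbb{E}_{x\sim\mathcal{D}}[\|\nabla_{\boldsymbol{w}}\mathcal{L}(x;\boldsymbol{w})-\nabla\ell(\boldsymbol{w})\|^2]\le\sigma^2$.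 Operator regularity assumption. There exist constants $C_{\nabla f},C_{\nabla^2 f},L_f,L_{\nabla f},L_{\nabla^2 f}>0$ such that for each $i$ and all $y_{i-1},w_i$: (1) $\|\nabla_j f_i(y_{i-1},w_i)\|_{\mathrm{op}}\le C_{\nabla f}$ for $j=1,2$ and $\|\nabla^2_{21}f_i(y_{i-1},w_i)\|_{\mathrm{op}}\le C_{\nabla^2 f}$; (2) $f_i$ is $L_f$-Lipschitz in $y_{i-1}$ (Euclidean norm); (3) $\nabla f_i$ and $\nabla^2 f_i$ are Lipschitz with respect to both $y_{i-1}$ and $w_i$ with constants $L_{\nabla f}$ and $L_{\nabla^2 f}$ respectively (Frobenius norm).
   Formalization: The backward filtration H_i also contains the current sample x^(t) (without it the claim fails); δ_i is zero-mean given G_{i-1} instead of G_i (a weaker assumption); the constants are chosen for a fixed underlying sample space. *)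

theory Defs
  imports "HOL-Probability.Probability"
begin

section \<open>Euclidean spaces of varying dimension\<close>

text \<open>
  The layer spaces have pairwise different dimensions, so they are represented by coordinate
  subspaces of a common ambient space: a nonempty set \<open>S\<close> of coordinates stands for the
  space of dimension \<open>card S\<close>, whose elements are the vectors that vanish outside \<open>S\<close>.
  An operator between such spaces is represented by its zero-padded extension, which ignores the
  irrelevant input coordinates and is zero in the irrelevant output coordinates.  Extension by
  zeros is a bijection that preserves differentiability and changes derivatives only by zero
  entries, hence it also preserves Euclidean, Frobenius and operator norms and Lipschitz
  constants.
\<close>

definition coord_space :: "'n::finite set \<Rightarrow> (real ^ 'n) set" where
  "coord_space S = {v. \<forall>k. k \<notin> S \<longrightarrow> v $ k = 0}"

definition coord_proj :: "'n::finite set \<Rightarrow> real ^ 'n \<Rightarrow> real ^ 'n" where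
  "coord_proj S v = (\<chi> k. if k \<in> S then v $ k else 0)"

type_synonym ('n, 'p) layer = "real ^ 'n \<Rightarrow> real ^ 'p \<Rightarrow> real ^ 'n"

definition padded_operator ::
    "'n::finite set \<Rightarrow> 'p::finite set \<Rightarrow> 'n set \<Rightarrow> ('n, 'p) layer \<Rightarrow> bool" where
  "padded_operator S V S' g \<longleftrightarrow>
     (\<forall>y w. g y w \<in> coord_space S' \<and> g y w = g (coord_proj S y) (coord_proj V w))"


section \<open>Derivatives\<close>

definition grad :: "(real ^ 'p::finite \<Rightarrow> real) \<Rightarrow> real ^ 'p \<Rightarrow> real ^ 'p" where
  "grad g w = (\<chi> k. frechet_derivative g (at w) (axis k 1))"

definition jac1 :: "('n::finite, 'p::finite) layer \<Rightarrow> real ^ 'n \<Rightarrow> real ^ 'p \<Rightarrow> real ^ 'n ^ 'n" where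
  "jac1 g y w = jacobian (\<lambda>y. g y w) (at y)"

definition jac2 ::
    "('n::finite, 'p::finite) layer \<Rightarrow> real ^ 'n \<Rightarrow> real ^ 'p \<Rightarrow> real ^ 'p ^ 'n" where
  "jac2 g y w = jacobian (\<lambda>w. g y w) (at w)"

text \<open>
  The library norm of iterated vectors and of pairs is the Euclidean one in all entries, so the
  norms of \<^term>\<open>full_jac g z\<close> and of \<open>full_hess g z\<close> below are the Frobenius norms of the first
  and of the second derivative of \<open>g\<close> with respect to both arguments.
\<close>

definition full_jac ::
    "('n::finite, 'p::finite) layer \<Rightarrow> (real ^ 'n) \<times> (real ^ 'p) \<Rightarrow>
      (real ^ 'n ^ 'n) \<times> (real ^ 'p ^ 'n)" where
  "full_jac g = (\<lambda>(y, w). (jac1 g y w, jac2 g y w))"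

definition tensor_deriv ::
    "(real ^ 'a::finite \<Rightarrow> real ^ 'b::finite ^ 'm::finite) \<Rightarrow> real ^ 'a
      \<Rightarrow> real ^ 'a ^ 'b ^ 'm" where
  "tensor_deriv J z = (\<chi> j \<alpha> \<beta>. frechet_derivative J (at z) (axis \<beta> 1) $ j $ \<alpha>)"

definition hess21 ::
    "('n::finite, 'p::finite) layer \<Rightarrow> real ^ 'n \<Rightarrow> real ^ 'p \<Rightarrow> real ^ 'n ^ 'p ^ 'n" where
  "hess21 g y w = tensor_deriv (\<lambda>y. jac2 g y w) y"

definition full_hess ::
    "('n::finite, 'p::finite) layer \<Rightarrow> (real ^ 'n) \<times> (real ^ 'p) \<Rightarrow>
      ((real ^ 'n ^ 'n ^ 'n) \<times> (real ^ 'p ^ 'n ^ 'n)) \<times>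
      ((real ^ 'n ^ 'p ^ 'n) \<times> (real ^ 'p ^ 'p ^ 'n))" where
  "full_hess g = (\<lambda>(y, w).
     ((tensor_deriv (\<lambda>y. jac1 g y w) y, tensor_deriv (\<lambda>w. jac1 g y w) w),
      (hess21 g y w, tensor_deriv (\<lambda>w. jac2 g y w) w)))"

definition tensor_apply ::
    "real ^ 'b::finite ^ 'a::finite ^ 'm::finite \<Rightarrow> real ^ 'b ^ 'a \<Rightarrow> real ^ 'm" where
  "tensor_apply H B = (\<chi> j. \<Sum>\<alpha>\<in>UNIV. \<Sum>\<beta>\<in>UNIV. H $ j $ \<alpha> $ \<beta> * B $ \<alpha> $ \<beta>)"

definition twice_differentiable :: "('n::finite, 'p::finite) layer \<Rightarrow> bool" where
  "twice_differentiable g \<longleftrightarrow>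
     (\<forall>z. (\<lambda>(y, w). g y w) differentiable (at z)) \<and>
     (\<forall>z. full_jac g differentiable (at z))"


section \<open>The compositional objective\<close>

primrec activation ::
    "(nat \<Rightarrow> ('n::finite, 'p::finite) layer) \<Rightarrow> real ^ 'p \<Rightarrow> real ^ 'n \<Rightarrow> nat \<Rightarrow> real ^ 'n" where
  "activation f w x 0 = x"
| "activation f w x (Suc i) = f (Suc i) (activation f w x i) w"

text \<open>The last layer is one-dimensional; \<open>out\<close> is its only coordinate.\<close>

definition sample_loss ::
    "nat \<Rightarrow> 'n::finite \<Rightarrow> (nat \<Rightarrow> ('n, 'p::finite) layer) \<Rightarrow> (real ^ 'p \<Rightarrow> real) \<Rightarrow>
      real ^ 'n \<Rightarrow> real ^ 'p \<Rightarrow> real" where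
  "sample_loss N out f R x w = activation f w x N $ out + R w"

definition expected_loss ::
    "nat \<Rightarrow> 'n::finite \<Rightarrow> (nat \<Rightarrow> ('n, 'p::finite) layer) \<Rightarrow> (real ^ 'p \<Rightarrow> real) \<Rightarrow>
      (real ^ 'n) measure \<Rightarrow> real ^ 'p \<Rightarrow> real" where
  "expected_loss N out f R D w = (\<integral>x. sample_loss N out f R x w \<partial>D)"

definition loss_smoothness :: "(real ^ 'p::finite \<Rightarrow> real) \<Rightarrow> bool" where
  "loss_smoothness l \<longleftrightarrow>
     (\<forall>w. l differentiable (at w)) \<and> (\<exists>L>0. L-lipschitz_on UNIV (grad l))"

definition stochasticity ::
    "(real ^ 'n::finite) measure \<Rightarrow> (real ^ 'n \<Rightarrow> real ^ 'p::finite \<Rightarrow> real) \<Rightarrow>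
      (real ^ 'p \<Rightarrow> real) \<Rightarrow> bool" where
  "stochasticity D L l \<longleftrightarrow> (\<exists>\<sigma>>0. \<forall>w.
     integrable D (\<lambda>x. grad (L x) w) \<and>
     (\<integral>x. grad (L x) w \<partial>D) = grad l w \<and>
     integrable D (\<lambda>x. (norm (grad (L x) w - grad l w))\<^sup>2) \<and>
     (\<integral>x. (norm (grad (L x) w - grad l w))\<^sup>2 \<partial>D) \<le> \<sigma>\<^sup>2)"

definition operator_regularity ::
    "nat \<Rightarrow> (nat \<Rightarrow> ('n::finite, 'p::finite) layer) \<Rightarrow> bool" where
  "operator_regularity N f \<longleftrightarrow>
     (\<exists>C1>0. \<exists>C2>0. \<exists>Lf>0. \<exists>L1>0. \<exists>L2>0. \<forall>i\<in>{1..N}.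
        (\<forall>y w. onorm ((*v) (jac1 (f i) y w)) \<le> C1 \<and>
               onorm ((*v) (jac2 (f i) y w)) \<le> C1 \<and>
               onorm (tensor_apply (hess21 (f i) y w)) \<le> C2) \<and>
        (\<forall>w. Lf-lipschitz_on UNIV (\<lambda>y. f i y w)) \<and>
        L1-lipschitz_on UNIV (full_jac (f i)) \<and>
        L2-lipschitz_on UNIV (full_hess (f i)))"


section \<open>Perturbed stochastic gradient descent\<close>

primrec pert_fwd ::
    "(nat \<Rightarrow> ('n::finite, 'p::finite) layer) \<Rightarrow> real ^ 'p \<Rightarrow> real ^ 'n \<Rightarrow> (nat \<Rightarrow> real ^ 'n) \<Rightarrow>
      nat \<Rightarrow> real ^ 'n" where
  "pert_fwd f w x \<delta> 0 = x"
| "pert_fwd f w x \<delta> (Suc i) = f (Suc i) (pert_fwd f w x \<delta> i) w + \<delta> (Suc i)"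

text \<open>The backward recursion, \<open>k\<close> steps below the last layer.\<close>

primrec pert_bwd_steps ::
    "nat \<Rightarrow> 'n::finite \<Rightarrow> (nat \<Rightarrow> ('n, 'p::finite) layer) \<Rightarrow> real ^ 'p \<Rightarrow>
      (nat \<Rightarrow> real ^ 'n) \<Rightarrow> (nat \<Rightarrow> real ^ 'n) \<Rightarrow> nat \<Rightarrow> real ^ 'n" where
  "pert_bwd_steps N out f w y \<epsilon> 0 = axis out 1"
| "pert_bwd_steps N out f w y \<epsilon> (Suc k) =
     transpose (jac1 (f (N - k)) (y (N - k - 1)) w) *v pert_bwd_steps N out f w y \<epsilon> k + \<epsilon> (N - k)"

definition pert_bwd ::
    "nat \<Rightarrow> 'n::finite \<Rightarrow> (nat \<Rightarrow> ('n, 'p::finite) layer) \<Rightarrow> real ^ 'p \<Rightarrow> real ^ 'n \<Rightarrow>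
      (nat \<Rightarrow> real ^ 'n) \<Rightarrow> (nat \<Rightarrow> real ^ 'n) \<Rightarrow> nat \<Rightarrow> real ^ 'n" where
  "pert_bwd N out f w x \<delta> \<epsilon> i = pert_bwd_steps N out f w (pert_fwd f w x \<delta>) \<epsilon> (N - i)"

definition pert_grad ::
    "nat \<Rightarrow> 'n::finite \<Rightarrow> (nat \<Rightarrow> ('n, 'p::finite) layer) \<Rightarrow> real ^ 'p \<Rightarrow> real ^ 'n \<Rightarrow>
      (nat \<Rightarrow> real ^ 'n) \<Rightarrow> (nat \<Rightarrow> real ^ 'n) \<Rightarrow> nat \<Rightarrow> real ^ 'p" where
  "pert_grad N out f w x \<delta> \<epsilon> i =
     transpose (jac2 (f i) (pert_fwd f w x \<delta> (i - 1)) w) *v pert_bwd N out f w x \<delta> \<epsilon> i"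

text \<open>
  \<open>W i\<close> is the set of coordinates of the weight block \<open>i\<close>.  The \<open>i\<close>-th summand of the update is
  supported on \<open>W i\<close> and the blocks are disjoint, so the single equation below updates every
  block separately.
\<close>

primrec psgd ::
    "nat \<Rightarrow> 'n::finite \<Rightarrow> (nat \<Rightarrow> 'p::finite set) \<Rightarrow> (nat \<Rightarrow> ('n, 'p) layer) \<Rightarrow>
      (real ^ 'p \<Rightarrow> real) \<Rightarrow> real ^ 'p \<Rightarrow> real \<Rightarrow>
      (nat \<Rightarrow> real ^ 'n) \<Rightarrow> (nat \<Rightarrow> nat \<Rightarrow> real ^ 'n) \<Rightarrow> (nat \<Rightarrow> nat \<Rightarrow> real ^ 'n) \<Rightarrow>
      nat \<Rightarrow> real ^ 'p" where
  "psgd N out W f R w0 \<gamma> x \<delta> \<epsilon> 0 = w0"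
| "psgd N out W f R w0 \<gamma> x \<delta> \<epsilon> (Suc t) =
     (let w = psgd N out W f R w0 \<gamma> x \<delta> \<epsilon> t in
      w - \<gamma> *\<^sub>R (\<Sum>i=1..N. pert_grad N out f w (x t) (\<delta> t) (\<epsilon> t) i
                          + coord_proj (W i) (grad R w)))"


section \<open>Conditions on the random run\<close>

definition adjoin ::
    "'o measure \<Rightarrow> 'o measure \<Rightarrow> ('o \<Rightarrow> 'b::topological_space) set \<Rightarrow> 'o measure" where
  "adjoin M F Y =
     sigma (space M) (sets F \<union> {X -` B \<inter> space M | X B. X \<in> Y \<and> B \<in> sets borel})"

definition cond_mean_zero ::
    "'o measure \<Rightarrow> 'o measure \<Rightarrow> ('o \<Rightarrow> real ^ 'n::finite) \<Rightarrow> bool" where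
  "cond_mean_zero M G X \<longleftrightarrow> (\<forall>k. AE \<omega> in M. real_cond_exp M G (\<lambda>\<omega>. X \<omega> $ k) \<omega> = 0)"

text \<open>
  \<open>w t\<close> are the iterates of a run of length \<open>T\<close>, driven by samples \<open>x t\<close> from \<open>D\<close> and
  perturbations \<open>\<delta> t i\<close>, \<open>\<epsilon> t i\<close>.  Any filtration with the two characteristic properties is
  allowed: the iterates are adapted, and the current sample is independent of the past.
\<close>

definition sampling_run ::
    "nat \<Rightarrow> (nat \<Rightarrow> 'n::finite set) \<Rightarrow> (real ^ 'n) measure \<Rightarrow> nat \<Rightarrow>
      'o measure \<Rightarrow> (nat \<Rightarrow> 'o measure) \<Rightarrow> (nat \<Rightarrow> 'o \<Rightarrow> real ^ 'p::finite) \<Rightarrow>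
      (nat \<Rightarrow> 'o \<Rightarrow> real ^ 'n) \<Rightarrow>
      (nat \<Rightarrow> nat \<Rightarrow> 'o \<Rightarrow> real ^ 'n) \<Rightarrow> (nat \<Rightarrow> nat \<Rightarrow> 'o \<Rightarrow> real ^ 'n) \<Rightarrow> bool" where
  "sampling_run N A D T M F w x \<delta> \<epsilon> \<longleftrightarrow>
     prob_space M \<and> filtration (space M) F \<and>
     (\<forall>t<T. subalgebra M (F t) \<and> w t \<in> borel_measurable (F t) \<and>
        x t \<in> borel_measurable M \<and> distr M borel (x t) = D \<and>
        prob_space.indep_set M (sets (F t)) {x t -` B \<inter> space M | B. B \<in> sets borel} \<and>
        (\<forall>i\<in>{1..N}. \<delta> t i \<in> borel_measurable M \<and> \<delta> t i ` space M \<subseteq> coord_space (A i)) \<and>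
        (\<forall>i\<in>{2..N}. \<epsilon> t i \<in> borel_measurable M \<and> \<epsilon> t i ` space M \<subseteq> coord_space (A (i - 1))))"

definition intermittent ::
    "real \<Rightarrow> nat \<Rightarrow> nat set \<Rightarrow> (nat \<Rightarrow> nat \<Rightarrow> 'o \<Rightarrow> bool) \<Rightarrow>
      (nat \<Rightarrow> nat \<Rightarrow> 'o \<Rightarrow> real ^ 'n::finite) \<Rightarrow> 'o \<Rightarrow> bool" where
  "intermittent c T I occ \<delta> \<omega> \<longleftrightarrow>
     (\<forall>t<T. \<forall>i\<in>I. if occ t i \<omega> then norm (\<delta> t i \<omega>) \<le> c else \<delta> t i \<omega> = 0)"

definition occurrences :: "nat \<Rightarrow> nat set \<Rightarrow> (nat \<Rightarrow> nat \<Rightarrow> 'o \<Rightarrow> bool) \<Rightarrow> 'o \<Rightarrow> nat" where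
  "occurrences T I occ \<omega> = card {(t, i). t < T \<and> i \<in> I \<and> occ t i \<omega>}"

text \<open>
  \<open>G t i\<close> is generated by the past and the perturbed forward values of the layers \<open>1\<close> to \<open>i\<close>,
  and \<open>H t i\<close> by the past, the sample (forward value \<open>0\<close>), all perturbed forward values, and the
  backward values of the layers \<open>N\<close> down to \<open>i\<close>.  The sample has to belong to \<open>H t i\<close>: otherwise
  \<open>\<epsilon> t i\<close> could be correlated with it, and the gradient of the first block would be biased to
  first order.  Since \<open>\<delta> t i\<close> enters the forward value \<open>i\<close>, its conditional mean is taken before
  that value is revealed, that is, given \<open>G t (i - 1)\<close>.  By the tower property this is weaker than
  the same condition given \<open>G t i\<close>, which would force \<open>\<delta> t i = 0\<close> almost surely for
  \<open>2 \<le> i \<le> N - 1\<close>.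
\<close>

definition zero_mean ::
    "nat \<Rightarrow> 'n::finite \<Rightarrow> (nat \<Rightarrow> ('n, 'p::finite) layer) \<Rightarrow> nat \<Rightarrow>
      'o measure \<Rightarrow> (nat \<Rightarrow> 'o measure) \<Rightarrow> (nat \<Rightarrow> 'o \<Rightarrow> real ^ 'p) \<Rightarrow>
      (nat \<Rightarrow> 'o \<Rightarrow> real ^ 'n) \<Rightarrow>
      (nat \<Rightarrow> nat \<Rightarrow> 'o \<Rightarrow> real ^ 'n) \<Rightarrow> (nat \<Rightarrow> nat \<Rightarrow> 'o \<Rightarrow> real ^ 'n) \<Rightarrow> bool" where
  "zero_mean N out f T M F w x \<delta> \<epsilon> \<longleftrightarrow>
     (let y = (\<lambda>t i \<omega>. pert_fwd f (w t \<omega>) (x t \<omega>) (\<lambda>j. \<delta> t j \<omega>) i);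
          v = (\<lambda>t i \<omega>. pert_bwd N out f (w t \<omega>) (x t \<omega>) (\<lambda>j. \<delta> t j \<omega>) (\<lambda>j. \<epsilon> t j \<omega>) i);
          G = (\<lambda>t i. adjoin M (F t) (y t ` {1..i}));
          H = (\<lambda>t i. adjoin M (G t N) (insert (y t 0) (v t ` {i..N})))
      in \<forall>t<T. \<forall>i\<in>{1..N - 1}.
           cond_mean_zero M (G t (i - 1)) (\<delta> t i) \<and>
           cond_mean_zero M (H t (i + 1)) (\<epsilon> t (i + 1)))"

end

theory Submission
  imports Defs
begin

text \<open>
  Write the update direction as the gradient of the loss plus three errors.  The sampling noise is
  orthogonal to the gradient in the mean, because the sample is independent of the past.  The
  effect of the backward perturbations is linear in them once the forward values are known, so by
  the zero-mean condition it is orthogonal to the gradient in the mean as well.  The remaining bias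
  is uniformly bounded and vanishes unless a forward perturbation occurs, so by Young's inequality
  it contributes \<open>O(Q\<^sub>\<delta>)\<close> to the sum of the descent inequalities; with \<open>Q\<^sub>\<delta> = O(T\<^sup>1\<^sup>/\<^sup>2)\<close> and
  a step size proportional to \<open>T\<^sup>-\<^sup>1\<^sup>/\<^sup>2\<close> this has the same order as all other terms.
  The update differs from the gradient by a bounded vector and the gradient is Lipschitz, so for a
  fixed horizon all iterates are bounded almost surely, which settles integrability.
\<close>

section \<open>Gradients as inner products and the quadratic upper bound\<close>

lemma grad_eqI:
  fixes g :: "real ^ 'p::finite \<Rightarrow> real"
  assumes "(g has_derivative (\<lambda>h. h \<bullet> v)) (at w)"
  shows "grad g w = v"
  using frechet_derivative_at[OF assms, symmetric] by (simp add: grad_def vec_eq_iff inner_axis')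

lemma has_derivative_grad:
  fixes g :: "real ^ 'p::finite \<Rightarrow> real"
  assumes "g differentiable (at w)"
  shows "(g has_derivative (\<lambda>h. h \<bullet> grad g w)) (at w)"
proof -
  let ?D = "frechet_derivative g (at w)"
  have D: "(g has_derivative ?D) (at w)"
    using assms by (simp add: frechet_derivative_works)
  have "?D h = h \<bullet> grad g w" for h
  proof -
    have "?D h = ?D (\<Sum>k\<in>UNIV. h $ k *\<^sub>R axis k 1)"
      by (simp add: basis_expansion scalar_mult_eq_scaleR[symmetric])
    also have "\<dots> = (\<Sum>k\<in>UNIV. h $ k * ?D (axis k 1))"
      using has_derivative_linear[OF D] by (simp add: linear_sum linear_scale)
    finally show ?thesis by (simp add: inner_vec_def grad_def)
  qed
  then have "?D = (\<lambda>h. h \<bullet> grad g w)" by auto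
  with D show ?thesis by simp
qed

text \<open>The mean value theorem evaluates the gradient at a point of the segment from
  \<open>w\<close> to \<open>w + d\<close>, and the Lipschitz condition controls its change from
  \<open>w\<close>. Using an intermediate point instead of an integral costs the factor 1/2
  customary in front of \<open>L\<close>, which affects only constants.\<close>

lemma smooth_upper_bound:
  fixes l :: "real ^ 'p::finite \<Rightarrow> real"
  assumes diff: "\<And>w. l differentiable (at w)" and lip: "L-lipschitz_on UNIV (grad l)"
  shows "l (w + d) \<le> l w + d \<bullet> grad l w + L * (norm d)\<^sup>2"
proof -
  have "((\<lambda>s. l (w + s *\<^sub>R d)) has_real_derivative d \<bullet> grad l (w + s *\<^sub>R d)) (at s)" for s
  proof -
    have "((\<lambda>s. w + s *\<^sub>R d) has_derivative (\<lambda>h. h *\<^sub>R d)) (at s)"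
      by (auto intro!: derivative_eq_intros)
    from has_derivative_compose[OF this has_derivative_grad[OF diff]]
    show ?thesis by (simp add: has_field_derivative_def mult_commute_abs)
  qed
  then obtain s where s: "0 < s" "s < 1" "l (w + d) - l w = d \<bullet> grad l (w + s *\<^sub>R d)"
    using MVT2[of 0 1 "\<lambda>s. l (w + s *\<^sub>R d)" "\<lambda>s. d \<bullet> grad l (w + s *\<^sub>R d)"] by auto
  have "d \<bullet> (grad l (w + s *\<^sub>R d) - grad l w) \<le> norm d * (L * norm (s *\<^sub>R d))"
    using norm_cauchy_schwarz[of d] lipschitz_onD[OF lip, of "w + s *\<^sub>R d" w]
    by (smt (verit) UNIV_I add_diff_cancel_left' dist_norm mult_left_mono norm_ge_zero)
  also have "\<dots> \<le> norm d * (L * norm d)"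
    using s lipschitz_on_nonneg[OF lip] by (intro mult_left_mono) (auto simp: mult_left_le_one_le)
  finally show ?thesis using s(3) by (simp add: inner_diff_right power2_eq_square algebra_simps)
qed

section \<open>Matrix-vector products: adjoint bound and measurability\<close>

text \<open>Operator bounds are available for Jacobians, while backpropagation applies their
  transposes. Pairing the image \<open>?u\<close> with itself moves the transpose to the other side,
  and Cauchy-Schwarz followed by division by \<open>norm ?u\<close> gives the bound.\<close>

lemma norm_transpose_mult_le:
  fixes J :: "real ^ 'a::finite ^ 'b::finite"
  shows "norm (transpose J *v v) \<le> onorm ((*v) J) * norm v"
proof -
  let ?u = "transpose J *v v"
  have "norm ?u * norm ?u = ?u \<bullet> ?u"
    by (metis power2_eq_square power2_norm_eq_inner)
  also have "\<dots> = v \<bullet> (J *v ?u)"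
    unfolding transpose_matrix_vector by (rule dot_lmul_matrix)
  also have "\<dots> \<le> norm v * norm (J *v ?u)"
    by (rule norm_cauchy_schwarz)
  also have "\<dots> \<le> norm v * (onorm ((*v) J) * norm ?u)"
    by (intro mult_left_mono onorm matrix_vector_mul_bounded_linear) simp
  finally have "norm ?u * norm ?u \<le> (onorm ((*v) J) * norm v) * norm ?u" by (simp add: ac_simps)
  then show ?thesis
    using onorm_pos_le[OF matrix_vector_mul_bounded_linear, of J]
    by (cases "norm ?u = 0") (auto simp: mult_le_cancel_right)
qed

lemma borel_measurable_transpose_mult [measurable]:
  fixes J :: "'a \<Rightarrow> real ^ 'b::finite ^ 'c::finite"
  assumes "J \<in> borel_measurable M" "v \<in> borel_measurable M"
  shows "(\<lambda>\<omega>. transpose (J \<omega>) *v v \<omega>) \<in> borel_measurable M"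
proof -
  have "continuous_on UNIV (\<lambda>z. transpose (fst z :: real ^ 'b ^ 'c) *v snd z)"
    unfolding matrix_vector_mult_def transpose_def by (intro continuous_intros)
  from borel_measurable_continuous_on[OF this borel_measurable_Pair[OF assms]]
  show ?thesis by simp
qed

lemma borel_measurable_matrix_mult [measurable]:
  fixes J :: "'a \<Rightarrow> real ^ 'b::finite ^ 'c::finite"
  assumes "J \<in> borel_measurable M" "v \<in> borel_measurable M"
  shows "(\<lambda>\<omega>. J \<omega> *v v \<omega>) \<in> borel_measurable M"
proof -
  have "continuous_on UNIV (\<lambda>z. (fst z :: real ^ 'b ^ 'c) *v snd z)"
    unfolding matrix_vector_mult_def by (intro continuous_intros)
  from borel_measurable_continuous_on[OF this borel_measurable_Pair[OF assms]]
  show ?thesis by simp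
qed

section \<open>A layered network: measurability, bounds and backpropagation\<close>

text \<open>Joint differentiability provides a total derivative \<open>G\<close>; its restrictions
  to the two factors are the partial Jacobians, and linearity reassembles \<open>G (a, b)\<close>
  from \<open>G (a, 0)\<close> and \<open>G (0, b)\<close>.\<close>

lemma twice_differentiable_has_derivative:
  assumes "twice_differentiable g"
  shows "((\<lambda>(y, w). g y w) has_derivative (\<lambda>(a, b). jac1 g y w *v a + jac2 g y w *v b)) (at (y, w))"
proof -
  obtain G where G: "((\<lambda>(y, w). g y w) has_derivative G) (at (y, w))"
    using assms unfolding twice_differentiable_def differentiable_def by blast
  have "((\<lambda>y. g y w) has_derivative (\<lambda>a. G (a, 0))) (at y)"
  proof -
    have "((\<lambda>y. (y, w)) has_derivative (\<lambda>a. (a, 0))) (at y)"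
      by (auto intro!: derivative_eq_intros)
    from has_derivative_compose[OF this G] show ?thesis by simp
  qed
  then have 1: "jac1 g y w *v a = G (a, 0)" for a
    by (simp add: jac1_def jacobian_def matrix_works has_derivative_linear
        frechet_derivative_at[symmetric])
  have "((\<lambda>w. g y w) has_derivative (\<lambda>b. G (0, b))) (at w)"
  proof -
    have "((\<lambda>w. (y, w)) has_derivative (\<lambda>b. (0, b))) (at w)"
      by (auto intro!: derivative_eq_intros)
    from has_derivative_compose[OF this G] show ?thesis by simp
  qed
  then have 2: "jac2 g y w *v b = G (0, b)" for b
    by (simp add: jac2_def jacobian_def matrix_works has_derivative_linear
        frechet_derivative_at[symmetric])
  have "G (a, b) = jac1 g y w *v a + jac2 g y w *v b" for a b
    using linear_add[OF has_derivative_linear[OF G], of "(a, 0)" "(0, b)"] by (simp add: 1 2)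
  then have "G = (\<lambda>(a, b). jac1 g y w *v a + jac2 g y w *v b)" by auto
  with G show ?thesis by simp
qed

locale layered_network =
  fixes N :: nat and out :: "'n::finite" and f :: "nat \<Rightarrow> ('n, 'p::finite) layer" and C :: real
  assumes twice_diff: "i \<in> {1..N} \<Longrightarrow> twice_differentiable (f i)"
    and jac1_le: "i \<in> {1..N} \<Longrightarrow> onorm ((*v) (jac1 (f i) y w)) \<le> C"
    and jac2_le: "i \<in> {1..N} \<Longrightarrow> onorm ((*v) (jac2 (f i) y w)) \<le> C"
    and C_nonneg: "0 \<le> C"
begin

lemma measurable_layer:
  assumes "i \<in> {1..N}" "Y \<in> borel_measurable M" "V \<in> borel_measurable M"
  shows "(\<lambda>\<omega>. f i (Y \<omega>) (V \<omega>)) \<in> borel_measurable M"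
proof -
  have "continuous_on UNIV (\<lambda>(y, w). f i y w)"
    using twice_diff[OF assms(1)] unfolding twice_differentiable_def
    by (auto intro!: continuous_at_imp_continuous_on differentiable_imp_continuous_within)
  from borel_measurable_continuous_on[OF this borel_measurable_Pair[OF assms(2,3)]]
  show ?thesis by simp
qed

lemma measurable_jac:
  assumes "i \<in> {1..N}" "Y \<in> borel_measurable M" "V \<in> borel_measurable M"
  shows "(\<lambda>\<omega>. jac1 (f i) (Y \<omega>) (V \<omega>)) \<in> borel_measurable M"
    "(\<lambda>\<omega>. jac2 (f i) (Y \<omega>) (V \<omega>)) \<in> borel_measurable M"
proof -
  have *: "continuous_on UNIV (full_jac (f i))"
    using twice_diff[OF assms(1)] unfolding twice_differentiable_def
    by (auto intro!: continuous_at_imp_continuous_on differentiable_imp_continuous_within)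
  show "(\<lambda>\<omega>. jac1 (f i) (Y \<omega>) (V \<omega>)) \<in> borel_measurable M"
    using borel_measurable_continuous_on[OF continuous_on_fst[OF *] borel_measurable_Pair[OF assms(2,3)]]
    by (simp add: full_jac_def)
  show "(\<lambda>\<omega>. jac2 (f i) (Y \<omega>) (V \<omega>)) \<in> borel_measurable M"
    using borel_measurable_continuous_on[OF continuous_on_snd[OF *] borel_measurable_Pair[OF assms(2,3)]]
    by (simp add: full_jac_def)
qed

lemma measurable_pert_fwd:
  assumes "V \<in> borel_measurable M" "X \<in> borel_measurable M"
    and "\<And>j. j \<in> {1..N} \<Longrightarrow> (\<lambda>\<omega>. d \<omega> j) \<in> borel_measurable M"
  shows "i \<le> N \<Longrightarrow> (\<lambda>\<omega>. pert_fwd f (V \<omega>) (X \<omega>) (d \<omega>) i) \<in> borel_measurable M"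
proof (induction i)
  case (Suc i)
  then show ?case
    unfolding pert_fwd.simps by (intro borel_measurable_add measurable_layer assms) auto
qed (simp add: assms)

text \<open>The index range in the premise on \<open>e\<close> matters: \<open>k\<close> backward
  steps read only the perturbations of the top \<open>k\<close> layers. Block
  \<open>i \<ge> 1\<close> takes \<open>N - i\<close> steps, so index 1, which carries no backward
  perturbation, is never reached.\<close>

lemma measurable_pert_bwd_steps:
  assumes "V \<in> borel_measurable M" "\<And>j. j < N \<Longrightarrow> (\<lambda>\<omega>. Y \<omega> j) \<in> borel_measurable M"
  shows "k \<le> N \<Longrightarrow> (\<And>j. j \<in> {N - k<..N} \<Longrightarrow> (\<lambda>\<omega>. e \<omega> j) \<in> borel_measurable M) \<Longrightarrow>
    (\<lambda>\<omega>. pert_bwd_steps N out f (V \<omega>) (Y \<omega>) (e \<omega>) k) \<in> borel_measurable M"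
proof (induction k)
  case (Suc k)
  have "(\<lambda>\<omega>. pert_bwd_steps N out f (V \<omega>) (Y \<omega>) (e \<omega>) k) \<in> borel_measurable M"
    using Suc.prems by (intro Suc.IH) auto
  then show ?case
    using Suc.prems assms
    by (auto simp del: transpose_matrix_vector
        intro!: borel_measurable_add borel_measurable_transpose_mult measurable_jac)
qed simp

lemma measurable_pert_grad:
  assumes "V \<in> borel_measurable M" "X \<in> borel_measurable M"
    and "\<And>j. j \<in> {1..N} \<Longrightarrow> (\<lambda>\<omega>. d \<omega> j) \<in> borel_measurable M"
    and "\<And>j. j \<in> {2..N} \<Longrightarrow> (\<lambda>\<omega>. e \<omega> j) \<in> borel_measurable M"
    and i: "i \<in> {1..N}"
  shows "(\<lambda>\<omega>. pert_grad N out f (V \<omega>) (X \<omega>) (d \<omega>) (e \<omega>) i) \<in> borel_measurable M"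
  unfolding pert_grad_def pert_bwd_def using i
  by (intro borel_measurable_transpose_mult measurable_jac measurable_pert_fwd
      measurable_pert_bwd_steps assms) auto

text \<open>One step turns a bound \<open>B\<close> into \<open>C * B + c\<close>. Powers of
  \<open>1 + C + c\<close> are at least 1, so they absorb the added \<open>c\<close> and the bound
  becomes geometric. \<open>k < N\<close> keeps the perturbation indices at 2 or above.\<close>

lemma norm_pert_bwd_steps_le:
  assumes "k < N" "\<And>j. j \<in> {2..N} \<Longrightarrow> norm (e j) \<le> c" "0 \<le> c"
  shows "norm (pert_bwd_steps N out f w y e k) \<le> (1 + C + c) ^ k"
  using assms(1)
proof (induction k)
  case (Suc k)
  let ?v = "pert_bwd_steps N out f w y e k"
  have 1: "1 \<le> (1 + C + c) ^ k" using C_nonneg assms by (intro one_le_power) auto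
  have "norm (transpose (jac1 (f (N - k)) (y (N - k - 1)) w) *v ?v)
      \<le> onorm ((*v) (jac1 (f (N - k)) (y (N - k - 1)) w)) * norm ?v"
    by (rule norm_transpose_mult_le)
  also have "\<dots> \<le> C * (1 + C + c) ^ k"
    using Suc C_nonneg by (intro mult_mono jac1_le) auto
  finally have "norm (pert_bwd_steps N out f w y e (Suc k)) \<le> C * (1 + C + c) ^ k + c"
    using assms(2)[of "N - k"] Suc.prems
    by (auto simp del: transpose_matrix_vector intro!: norm_triangle_le add_mono)
  also have "\<dots> \<le> (1 + C + c) ^ Suc k"
    using 1 \<open>0 \<le> c\<close> mult_left_mono[OF 1 \<open>0 \<le> c\<close>] by (simp add: algebra_simps)
  finally show ?case .
qed simp

text \<open>Bound for the summed gradients under backward perturbations of size at most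
  \<open>c\<close>: each of the \<open>N\<close> blocks costs a factor \<open>C\<close> for
  \<open>jac2\<close> and fewer than \<open>N\<close> backward steps. Forward perturbations may have
  any size, because the Jacobian bounds are global.\<close>

definition grad_bound :: "real \<Rightarrow> real" where
  "grad_bound c = real N * (C * (1 + C + c) ^ N)"

lemma norm_sum_pert_grad_le:
  assumes "\<And>j. j \<in> {2..N} \<Longrightarrow> norm (e j) \<le> c" "0 \<le> c"
  shows "norm (\<Sum>i=1..N. pert_grad N out f w x d e i) \<le> grad_bound c"
proof -
  have "norm (pert_grad N out f w x d e i) \<le> C * (1 + C + c) ^ N" if i: "i \<in> {1..N}" for i
  proof -
    have "norm (pert_bwd N out f w x d e i) \<le> (1 + C + c) ^ (N - i)"
      unfolding pert_bwd_def using i assms by (intro norm_pert_bwd_steps_le) auto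
    also have "\<dots> \<le> (1 + C + c) ^ N"
      using C_nonneg assms by (intro power_increasing) auto
    finally show ?thesis
      unfolding pert_grad_def using i C_nonneg
      by (intro order_trans[OF norm_transpose_mult_le] mult_mono jac2_le) auto
  qed
  then show ?thesis
    unfolding grad_bound_def by (intro order_trans[OF sum_norm_bound]) auto
qed

text \<open>By \<open>has_derivative_output\<close> this is the gradient of the scalar network
  output with respect to the weights.\<close>

definition backprop :: "real ^ 'n \<Rightarrow> real ^ 'p \<Rightarrow> real ^ 'p" where
  "backprop x w = (\<Sum>i=1..N. pert_grad N out f w x (\<lambda>_. 0) (\<lambda>_. 0) i)"

lemma norm_backprop_le: "0 \<le> c \<Longrightarrow> norm (backprop x w) \<le> grad_bound c"
  unfolding backprop_def by (rule norm_sum_pert_grad_le) auto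

lemma measurable_backprop:
  assumes "X \<in> borel_measurable M" "V \<in> borel_measurable M"
  shows "(\<lambda>\<omega>. backprop (X \<omega>) (V \<omega>)) \<in> borel_measurable M"
  unfolding backprop_def by (intro borel_measurable_sum measurable_pert_grad assms) auto

text \<open>Forward-mode differentiation along \<open>h\<close>. It starts at 0 since the input does
  not depend on the weights.\<close>

primrec activation_deriv :: "real ^ 'p \<Rightarrow> real ^ 'n \<Rightarrow> nat \<Rightarrow> real ^ 'p \<Rightarrow> real ^ 'n" where
  "activation_deriv w x 0 h = 0"
| "activation_deriv w x (Suc i) h =
     jac1 (f (Suc i)) (activation f w x i) w *v activation_deriv w x i h
     + jac2 (f (Suc i)) (activation f w x i) w *v h"

lemma has_derivative_activation:
  "i \<le> N \<Longrightarrow> ((\<lambda>w. activation f w x i) has_derivative activation_deriv w x i) (at w)"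
proof (induction i)
  case 0
  have "activation_deriv w x 0 = (\<lambda>_. 0)" by auto
  then show ?case by simp
next
  case (Suc i)
  have "((\<lambda>w. (activation f w x i, w)) has_derivative (\<lambda>h. (activation_deriv w x i h, h))) (at w)"
    using Suc by (intro derivative_intros) auto
  from has_derivative_compose[OF this twice_differentiable_has_derivative[OF twice_diff, of "Suc i"]]
  show ?case using Suc.prems by (simp add: fun_eq_iff)
qed

lemma pert_fwd_zero: "pert_fwd f w x (\<lambda>_. 0) i = activation f w x i"
  by (induction i) auto

text \<open>Forward and reverse mode agree: one backward step moves a transposed Jacobian across the
  inner product, so the pairing at layer \<open>N - k\<close> becomes a pairing one layer below plus
  the contribution of the weights of layer \<open>N - k\<close>. At \<open>k = N\<close> the pairing
  vanishes with the derivative of the input, and only the sum remains.\<close>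

lemma backprop_telescope:
  "k \<le> N \<Longrightarrow> axis out 1 \<bullet> activation_deriv w x N h =
    pert_bwd_steps N out f w (activation f w x) (\<lambda>_. 0) k \<bullet> activation_deriv w x (N - k) h
    + (\<Sum>i\<in>{N - k<..N}. h \<bullet> pert_grad N out f w x (\<lambda>_. 0) (\<lambda>_. 0) i)"
proof (induction k)
  case (Suc k)
  define m where "m = N - Suc k"
  then have m: "N - k = Suc m" "{N - Suc k<..N} = insert (Suc m) {N - k<..N}" "N - Suc m = k"
    using Suc.prems by auto
  let ?v = "pert_bwd_steps N out f w (activation f w x) (\<lambda>_. 0) k"
  have "?v \<bullet> activation_deriv w x (N - k) h =
      pert_bwd_steps N out f w (activation f w x) (\<lambda>_. 0) (Suc k) \<bullet> activation_deriv w x m h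
      + h \<bullet> pert_grad N out f w x (\<lambda>_. 0) (\<lambda>_. 0) (Suc m)"
    by (simp add: m pert_grad_def pert_bwd_def pert_fwd_zero[abs_def] inner_add_right
        inner_commute[of h] dot_lmul_matrix)
  then show ?case
    using Suc m(1) unfolding m(2) by (simp add: m_def)
qed simp

lemma has_derivative_output:
  "((\<lambda>w. activation f w x N $ out) has_derivative (\<lambda>h. h \<bullet> backprop x w)) (at w)"
proof -
  have "((\<lambda>w. axis out 1 \<bullet> activation f w x N) has_derivative
      (\<lambda>h. axis out 1 \<bullet> activation_deriv w x N h)) (at w)"
    by (intro derivative_intros has_derivative_activation) simp
  moreover have "{0<..N} = {1..N}" by auto
  ultimately show ?thesis
    using backprop_telescope[of N w x]
    by (simp add: backprop_def inner_sum_right inner_axis')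
qed

lemma grad_sample_loss:
  assumes "R differentiable (at w)"
  shows "grad (sample_loss N out f R x) w = backprop x w + grad R w"
proof (rule grad_eqI)
  show "(sample_loss N out f R x has_derivative (\<lambda>h. h \<bullet> (backprop x w + grad R w))) (at w)"
    unfolding sample_loss_def inner_add_right
    by (intro has_derivative_add has_derivative_output has_derivative_grad assms)
qed

lemma pert_fwd_cong:
  assumes "\<And>j. j \<in> {1..N} \<Longrightarrow> d j = d' j"
  shows "i \<le> N \<Longrightarrow> pert_fwd f w x d i = pert_fwd f w x d' i"
  by (induction i) (simp_all add: assms)

lemma pert_bwd_steps_cong:
  assumes "\<And>j. j < N \<Longrightarrow> y j = y' j"
  shows "k \<le> N \<Longrightarrow> pert_bwd_steps N out f w y e k = pert_bwd_steps N out f w y' e k"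
  by (induction k) (simp_all add: assms)

text \<open>This makes the bias vanish in iterations without forward perturbation. Outside the
  layers \<open>1..N\<close> the function \<open>d\<close> is arbitrary, hence the detour through
  the congruence rules.\<close>

lemma pert_grad_unperturbed:
  assumes "\<And>j. j \<in> {1..N} \<Longrightarrow> d j = 0"
  shows "(\<Sum>i=1..N. pert_grad N out f w x d (\<lambda>_. 0) i) = backprop x w"
  unfolding backprop_def
proof (rule sum.cong)
  fix i assume i: "i \<in> {1..N}"
  have *: "pert_fwd f w x d j = pert_fwd f w x (\<lambda>_. 0) j" if "j \<le> N" for j
    using assms that by (intro pert_fwd_cong) auto
  have "pert_bwd N out f w x d (\<lambda>_. 0) i = pert_bwd N out f w x (\<lambda>_. 0) (\<lambda>_. 0) i"
    unfolding pert_bwd_def by (rule pert_bwd_steps_cong) (simp_all add: *)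
  then show "pert_grad N out f w x d (\<lambda>_. 0) i = pert_grad N out f w x (\<lambda>_. 0) (\<lambda>_. 0) i"
    unfolding pert_grad_def using i *[of "i - 1"] by auto
qed simp

end

section \<open>Sigma-algebras generated by adjoining random vectors\<close>

lemma sets_adjoin:
  assumes "subalgebra M F"
  shows "sets (adjoin M F Y) = sigma_sets (space M)
    (sets F \<union> {X -` B \<inter> space M | X B. X \<in> Y \<and> B \<in> sets borel})"
proof -
  have "sets F \<subseteq> Pow (space M)"
    using assms sets.space_closed[of M] unfolding subalgebra_def by blast
  then show ?thesis unfolding adjoin_def by (intro sets_measure_of) auto
qed

lemma space_adjoin [simp]: "space (adjoin M F Y) = space M"
  unfolding adjoin_def by (rule space_measure_of_conv)

lemma measurable_adjoin_past:
  assumes "subalgebra M F" "g \<in> measurable F L"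
  shows "g \<in> measurable (adjoin M F Y) L"
proof (rule measurable_from_subalg[OF _ assms(2)])
  show "subalgebra (adjoin M F Y) F"
    using assms(1) by (auto simp: subalgebra_def sets_adjoin[OF assms(1)])
qed

lemma measurable_adjoin_member:
  assumes "subalgebra M F" "X \<in> Y"
  shows "X \<in> borel_measurable (adjoin M F Y)"
  using assms(2) by (intro measurableI) (auto simp: sets_adjoin[OF assms(1)])

lemma subalgebra_adjoin:
  assumes "subalgebra M F" "\<And>X. X \<in> Y \<Longrightarrow> X \<in> borel_measurable M"
  shows "subalgebra M (adjoin M F Y)"
proof -
  have "sets F \<union> {X -` B \<inter> space M | X B. X \<in> Y \<and> B \<in> sets borel} \<subseteq> sets M"
    using assms(1) measurable_sets[OF assms(2)] by (auto simp: subalgebra_def)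
  then show ?thesis
    unfolding subalgebra_def sets_adjoin[OF assms(1)] by (simp add: sets.sigma_sets_subset)
qed

lemma subalgebra_adjoin_mono:
  assumes "subalgebra M F" "Y \<subseteq> Z"
  shows "subalgebra (adjoin M F Z) (adjoin M F Y)"
  using assms(2) unfolding subalgebra_def sets_adjoin[OF assms(1)]
  by (auto intro!: sigma_sets_mono' simp del: Un_iff)

section \<open>Zero conditional mean and independence\<close>

context prob_space
begin

lemma integrable_inner_AE_bounded:
  fixes g h :: "'a \<Rightarrow> 'b::euclidean_space"
  assumes "g \<in> borel_measurable M" "h \<in> borel_measurable M"
    and "AE \<omega> in M. norm (g \<omega>) \<le> b" "AE \<omega> in M. norm (h \<omega>) \<le> c"
  shows "integrable M (\<lambda>\<omega>. g \<omega> \<bullet> h \<omega>)"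
proof (rule integrable_const_bound[where B = "b * c"])
  show "AE \<omega> in M. norm (g \<omega> \<bullet> h \<omega>) \<le> b * c"
    using assms(3,4)
  proof eventually_elim
    case (elim \<omega>)
    show ?case
      using elim Cauchy_Schwarz_ineq2[of "g \<omega>" "h \<omega>"]
        mult_mono[OF elim order_trans[OF norm_ge_zero elim(1)] norm_ge_zero]
      by simp
  qed
qed (use assms in measurable)

text \<open>In each coordinate the \<open>G\<close>-measurable factor \<open>h\<close> is kept while
  \<open>X\<close> is replaced under the integral by its conditional expectation, which is 0. The
  almost sure bounds make the products integrable.\<close>

lemma cond_mean_zero_integral:
  fixes X h :: "'a \<Rightarrow> real ^ 'n::finite"
  assumes G: "subalgebra M G" "cond_mean_zero M G X"
    and X: "X \<in> borel_measurable M" "AE \<omega> in M. norm (X \<omega>) \<le> c"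
    and h: "h \<in> borel_measurable G" "AE \<omega> in M. norm (h \<omega>) \<le> b"
  shows "(\<integral>\<omega>. h \<omega> \<bullet> X \<omega> \<partial>M) = 0"
proof -
  interpret G: finite_measure_subalgebra M G by unfold_locales (rule G)
  have hM: "h \<in> borel_measurable M" by (rule measurable_from_subalg[OF G(1) h(1)])
  have meas: "(\<lambda>\<omega>. g \<omega> $ k) \<in> borel_measurable L"
    if "g \<in> borel_measurable L" for g :: "'a \<Rightarrow> real ^ 'n" and L k
    using borel_measurable_inner[OF that borel_measurable_const[of "axis k 1"]]
    by (simp add: inner_axis)
  have le: "AE \<omega> in M. norm (g \<omega> $ k) \<le> a"
    if "AE \<omega> in M. norm (g \<omega>) \<le> a" for g :: "'a \<Rightarrow> real ^ 'n" and k a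
    using that by eventually_elim (use component_le_norm_cart order_trans in \<open>simp, blast\<close>)
  have int: "integrable M (\<lambda>\<omega>. h \<omega> $ k * X \<omega> $ k)" for k
    using integrable_inner_AE_bounded[OF meas[OF hM] meas[OF X(1)] le[OF h(2)] le[OF X(2)]]
    by simp
  have zero: "(\<integral>\<omega>. h \<omega> $ k * X \<omega> $ k \<partial>M) = 0" for k
  proof -
    have "(\<integral>\<omega>. h \<omega> $ k * X \<omega> $ k \<partial>M)
        = (\<integral>\<omega>. h \<omega> $ k * real_cond_exp M G (\<lambda>\<omega>. X \<omega> $ k) \<omega> \<partial>M)"
      by (rule G.real_cond_exp_intg(2)[symmetric]) (intro int meas h X)+
    also have "\<dots> = (\<integral>\<omega>. 0 \<partial>M)"
    proof (rule integral_cong_AE)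
      show "AE \<omega> in M. h \<omega> $ k * real_cond_exp M G (\<lambda>\<omega>. X \<omega> $ k) \<omega> = 0"
        using G(2) unfolding cond_mean_zero_def by auto
    qed (use meas[OF hM] in measurable)
    finally show ?thesis by simp
  qed
  show ?thesis unfolding inner_vec_def using int zero by simp
qed

text \<open>Turns independence of the sample from the past into a product law of sample and weights,
  ready for Fubini. Agreement on rectangles suffices, and there it is the product rule for
  independent events.\<close>

lemma distr_Pair_indep_set:
  fixes x :: "'a \<Rightarrow> 'b::second_countable_topology" and w :: "'a \<Rightarrow> 'c::second_countable_topology"
  assumes F: "subalgebra M F" "w \<in> borel_measurable F"
    and x [measurable]: "x \<in> borel_measurable M"
    and indep: "indep_set (sets F) {x -` B \<inter> space M | B. B \<in> sets borel}"
  shows "distr M borel x \<Otimes>\<^sub>M distr M borel w = distr M (borel \<Otimes>\<^sub>M borel) (\<lambda>\<omega>. (x \<omega>, w \<omega>))"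
proof (rule pair_measure_eqI)
  have w [measurable]: "w \<in> borel_measurable M" by (rule measurable_from_subalg[OF F])
  have sp: "space F = space M" using F by (simp add: subalgebra_def)
  interpret X: prob_space "distr M borel x" by (rule prob_space_distr) simp
  interpret W: prob_space "distr M borel w" by (rule prob_space_distr) simp
  show "sigma_finite_measure (distr M borel x)" "sigma_finite_measure (distr M borel w)" ..
  fix A B assume A: "A \<in> sets (distr M borel x)" and B: "B \<in> sets (distr M borel w)"
  have [measurable]: "A \<in> sets borel" "B \<in> sets borel" using A B by auto
  have "prob ((w -` B \<inter> space M) \<inter> (x -` A \<inter> space M)) = prob (w -` B \<inter> space M) * prob (x -` A \<inter> space M)"
    using measurable_sets[OF F(2), of B] by (intro indep_setD[OF indep]) (auto simp: sp)
  moreover have "(\<lambda>\<omega>. (x \<omega>, w \<omega>)) -` (A \<times> B) \<inter> space M = (w -` B \<inter> space M) \<inter> (x -` A \<inter> space M)"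
    by auto
  ultimately show "emeasure (distr M borel x) A * emeasure (distr M borel w) B
      = emeasure (distr M (borel \<Otimes>\<^sub>M borel) (\<lambda>\<omega>. (x \<omega>, w \<omega>))) (A \<times> B)"
    by (simp add: emeasure_distr emeasure_eq_measure ennreal_mult[symmetric] mult.commute)
qed (simp cong: sets_pair_measure_cong)

end

section \<open>Orthogonality of sampling noise and backward noise in one iteration\<close>

text \<open>A single iteration with the time index dropped. In \<open>bwd_noise_mean\<close> the
  revealed backward values go down to \<open>v i\<close> inclusive: \<open>\<epsilon> i\<close>
  first enters \<open>v (i - 1)\<close>, so these are the backward values computed before
  it.\<close>

locale perturbed_step = layered_network N out f C + prob_space M
  for N and out :: "'n::finite" and f :: "nat \<Rightarrow> ('n, 'p::finite) layer" and C and M :: "'o measure" +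
  fixes F :: "'o measure" and w :: "'o \<Rightarrow> real ^ 'p" and x :: "'o \<Rightarrow> real ^ 'n"
    and \<delta> \<epsilon> :: "nat \<Rightarrow> 'o \<Rightarrow> real ^ 'n" and c :: real
  assumes past: "subalgebra M F" "w \<in> borel_measurable F"
    and sample: "x \<in> borel_measurable M"
      "indep_set (sets F) {x -` B \<inter> space M | B. B \<in> sets borel}"
    and measurable_noise: "i \<in> {1..N} \<Longrightarrow> \<delta> i \<in> borel_measurable M"
      "i \<in> {2..N} \<Longrightarrow> \<epsilon> i \<in> borel_measurable M"
    and c_nonneg: "0 \<le> c"
    and bwd_noise_le: "AE \<omega> in M. \<forall>i\<in>{2..N}. norm (\<epsilon> i \<omega>) \<le> c"
    and bwd_noise_mean: "i \<in> {2..N} \<Longrightarrow> cond_mean_zero M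
      (adjoin M (adjoin M F ((\<lambda>i \<omega>. pert_fwd f (w \<omega>) (x \<omega>) (\<lambda>j. \<delta> j \<omega>) i) ` {1..N}))
        (insert (\<lambda>\<omega>. pert_fwd f (w \<omega>) (x \<omega>) (\<lambda>j. \<delta> j \<omega>) 0)
          ((\<lambda>i \<omega>. pert_bwd N out f (w \<omega>) (x \<omega>) (\<lambda>j. \<delta> j \<omega>) (\<lambda>j. \<epsilon> j \<omega>) i) ` {i..N})))
      (\<epsilon> i)"
begin

abbreviation y :: "nat \<Rightarrow> 'o \<Rightarrow> real ^ 'n" where
  "y i \<omega> \<equiv> pert_fwd f (w \<omega>) (x \<omega>) (\<lambda>j. \<delta> j \<omega>) i"

abbreviation v :: "nat \<Rightarrow> 'o \<Rightarrow> real ^ 'n" where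
  "v i \<omega> \<equiv> pert_bwd N out f (w \<omega>) (x \<omega>) (\<lambda>j. \<delta> j \<omega>) (\<lambda>j. \<epsilon> j \<omega>) i"

definition forward_info :: "'o measure" where
  "forward_info = adjoin M F (y ` {1..N})"

definition backward_info :: "nat \<Rightarrow> 'o measure" where
  "backward_info i = adjoin M forward_info (insert (y 0) (v ` {i..N}))"

lemma measurable_weights: "w \<in> borel_measurable M"
  by (rule measurable_from_subalg[OF past])

lemma measurable_forward: "i \<le> N \<Longrightarrow> y i \<in> borel_measurable M"
  by (intro measurable_pert_fwd measurable_weights sample measurable_noise)

lemma measurable_backward: "i \<in> {1..N} \<Longrightarrow> v i \<in> borel_measurable M"
  unfolding pert_bwd_def
  by (intro measurable_pert_bwd_steps measurable_forward measurable_weights measurable_noise) auto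

lemma subalgebra_forward_info: "subalgebra M forward_info"
  unfolding forward_info_def using measurable_forward by (intro subalgebra_adjoin past) auto

lemma subalgebra_backward_info: "1 \<le> i \<Longrightarrow> subalgebra M (backward_info i)"
  unfolding backward_info_def using measurable_forward[of 0] measurable_backward
  by (intro subalgebra_adjoin subalgebra_forward_info) auto

text \<open>\<^term>\<open>backward_info (Suc N)\<close> contains no backward value at all.\<close>

lemma measurable_known:
  shows "w \<in> borel_measurable (backward_info (Suc N))"
    and "i \<le> N \<Longrightarrow> y i \<in> borel_measurable (backward_info (Suc N))"
proof -
  show "w \<in> borel_measurable (backward_info (Suc N))"
    unfolding backward_info_def forward_info_def
    by (intro measurable_adjoin_past past subalgebra_forward_info[unfolded forward_info_def])
  show "y i \<in> borel_measurable (backward_info (Suc N))" if "i \<le> N"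
  proof (cases "i = 0")
    case True
    then show ?thesis
      unfolding backward_info_def by (intro measurable_adjoin_member subalgebra_forward_info) auto
  next
    case False
    then have "y i \<in> borel_measurable forward_info"
      unfolding forward_info_def using that by (intro measurable_adjoin_member past) auto
    then show ?thesis
      unfolding backward_info_def by (intro measurable_adjoin_past subalgebra_forward_info)
  qed
qed

text \<open>The test vector is measurable for the smallest of these sigma-algebras, which lies
  inside every \<open>backward_info i\<close>. One class of test vectors thus serves all layers at
  once.\<close>

lemma bwd_noise_orthogonal:
  assumes i: "i \<in> {2..N}" and h: "h \<in> borel_measurable (backward_info (Suc N))"
    and le: "AE \<omega> in M. norm (h \<omega>) \<le> b"
  shows "integrable M (\<lambda>\<omega>. h \<omega> \<bullet> \<epsilon> i \<omega>)" "(\<integral>\<omega>. h \<omega> \<bullet> \<epsilon> i \<omega> \<partial>M) = 0"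
proof -
  have \<epsilon>: "AE \<omega> in M. norm (\<epsilon> i \<omega>) \<le> c"
    using bwd_noise_le by eventually_elim (use i in auto)
  have "subalgebra (backward_info i) (backward_info (Suc N))"
    unfolding backward_info_def by (intro subalgebra_adjoin_mono subalgebra_forward_info) auto
  then have h': "h \<in> borel_measurable (backward_info i)"
    by (rule measurable_from_subalg[OF _ h])
  have sub: "subalgebra M (backward_info i)" using i by (intro subalgebra_backward_info) auto
  show "integrable M (\<lambda>\<omega>. h \<omega> \<bullet> \<epsilon> i \<omega>)"
    using measurable_from_subalg[OF sub h'] measurable_noise(2)[OF i] le \<epsilon>
    by (rule integrable_inner_AE_bounded)
  show "(\<integral>\<omega>. h \<omega> \<bullet> \<epsilon> i \<omega> \<partial>M) = 0"
    using sub bwd_noise_mean[OF i, folded forward_info_def, folded backward_info_def]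
      measurable_noise(2)[OF i] \<epsilon> h' le
    by (rule cond_mean_zero_integral)
qed

text \<open>Both recursions run on the same perturbed forward values, hence with the same Jacobians;
  their difference is therefore linear in the backward perturbations.\<close>

definition noise_part :: "nat \<Rightarrow> 'o \<Rightarrow> real ^ 'n" where
  "noise_part k \<omega> =
     pert_bwd_steps N out f (w \<omega>) (\<lambda>j. y j \<omega>) (\<lambda>j. \<epsilon> j \<omega>) k
     - pert_bwd_steps N out f (w \<omega>) (\<lambda>j. y j \<omega>) (\<lambda>_. 0) k"

text \<open>
  The backward recursion is affine in the noise, so moving the transposed Jacobians to the test
  vector reduces everything to single backward perturbations.
\<close>

lemma noise_part_orthogonal:
  assumes "k < N" "h \<in> borel_measurable (backward_info (Suc N))" "AE \<omega> in M. norm (h \<omega>) \<le> b"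
  shows "integrable M (\<lambda>\<omega>. h \<omega> \<bullet> noise_part k \<omega>) \<and> (\<integral>\<omega>. h \<omega> \<bullet> noise_part k \<omega> \<partial>M) = 0"
  using assms
\<comment> \<open>Each step replaces \<open>h\<close> by its image under a Jacobian and
  \<open>b\<close> by \<open>C * b\<close>, so both have to be general.\<close>
proof (induction k arbitrary: h b)
  case 0
  then show ?case by (simp add: noise_part_def)
next
  case (Suc k)
  let ?J = "\<lambda>\<omega>. jac1 (f (N - k)) (y (N - k - 1) \<omega>) (w \<omega>)"
  let ?g = "\<lambda>\<omega>. ?J \<omega> *v h \<omega>"
  have split: "h \<omega> \<bullet> noise_part (Suc k) \<omega> = ?g \<omega> \<bullet> noise_part k \<omega> + h \<omega> \<bullet> \<epsilon> (N - k) \<omega>" for \<omega>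
    by (simp add: noise_part_def inner_add_right inner_diff_right inner_commute[of "h \<omega>"]
        inner_commute[of "jac1 _ _ _ *v h \<omega>"] dot_lmul_matrix)
  have g: "?g \<in> borel_measurable (backward_info (Suc N))"
    using Suc.prems by (intro borel_measurable_matrix_mult measurable_jac measurable_known) auto
  have "AE \<omega> in M. norm (?g \<omega>) \<le> C * b"
    using Suc.prems(3)
  proof eventually_elim
    case (elim \<omega>)
    have "norm (?g \<omega>) \<le> onorm ((*v) (?J \<omega>)) * norm (h \<omega>)"
      by (intro onorm matrix_vector_mul_bounded_linear)
    also have "\<dots> \<le> C * b"
      using elim C_nonneg Suc.prems(1) by (intro mult_mono jac1_le) auto
    finally show ?case .
  qed
  note IH = Suc.IH[OF Suc_lessD[OF Suc.prems(1)] g this]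
  have "N - k \<in> {2..N}" using Suc.prems(1) by auto
  note \<epsilon> = bwd_noise_orthogonal[OF this Suc.prems(2,3)]
  show ?case unfolding split using IH \<epsilon> by simp
qed

text \<open>Block \<open>i\<close> contributes a transposed \<open>jac2\<close> applied to
  \<open>noise_part (N - i)\<close>. Moved to \<open>h\<close>, the Jacobian yields a test vector
  that is still bounded and determined by the past and the forward pass, so
  \<open>noise_part_orthogonal\<close> applies blockwise.\<close>

lemma gradient_noise_orthogonal:
  assumes h: "h \<in> borel_measurable (backward_info (Suc N))" "AE \<omega> in M. norm (h \<omega>) \<le> b"
  shows "(\<integral>\<omega>. h \<omega> \<bullet>
      ((\<Sum>i=1..N. pert_grad N out f (w \<omega>) (x \<omega>) (\<lambda>j. \<delta> j \<omega>) (\<lambda>j. \<epsilon> j \<omega>) i)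
       - (\<Sum>i=1..N. pert_grad N out f (w \<omega>) (x \<omega>) (\<lambda>j. \<delta> j \<omega>) (\<lambda>_. 0) i)) \<partial>M) = 0"
proof -
  let ?g = "\<lambda>i \<omega>. jac2 (f i) (y (i - 1) \<omega>) (w \<omega>) *v h \<omega>"
  have split: "h \<omega> \<bullet>
      ((\<Sum>i=1..N. pert_grad N out f (w \<omega>) (x \<omega>) (\<lambda>j. \<delta> j \<omega>) (\<lambda>j. \<epsilon> j \<omega>) i)
       - (\<Sum>i=1..N. pert_grad N out f (w \<omega>) (x \<omega>) (\<lambda>j. \<delta> j \<omega>) (\<lambda>_. 0) i))
      = (\<Sum>i=1..N. ?g i \<omega> \<bullet> noise_part (N - i) \<omega>)" for \<omega>
    by (simp add: noise_part_def pert_grad_def pert_bwd_def inner_sum_right inner_diff_right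
        inner_commute[of "h \<omega>"] inner_commute[of "jac2 _ _ _ *v h \<omega>"] dot_lmul_matrix
        sum_subtractf)
  have "integrable M (\<lambda>\<omega>. ?g i \<omega> \<bullet> noise_part (N - i) \<omega>) \<and>
      (\<integral>\<omega>. ?g i \<omega> \<bullet> noise_part (N - i) \<omega> \<partial>M) = 0" if i: "i \<in> {1..N}" for i
  proof (rule noise_part_orthogonal)
    show "?g i \<in> borel_measurable (backward_info (Suc N))"
      using i by (intro borel_measurable_matrix_mult measurable_jac measurable_known h) auto
    show "AE \<omega> in M. norm (?g i \<omega>) \<le> C * b"
      using h(2)
    proof eventually_elim
      case (elim \<omega>)
      have "norm (?g i \<omega>) \<le> onorm ((*v) (jac2 (f i) (y (i - 1) \<omega>) (w \<omega>))) * norm (h \<omega>)"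
        by (intro onorm matrix_vector_mul_bounded_linear)
      also have "\<dots> \<le> C * b"
        using elim C_nonneg i by (intro mult_mono jac2_le) auto
      finally show ?case .
    qed
  qed (use i in auto)
  then show ?thesis unfolding split by (simp add: Bochner_Integration.integral_sum)
qed

text \<open>Expectation over a fresh sample with the weights frozen at \<open>u\<close>. In a run
  the law of \<open>x\<close> is \<open>D\<close>, and this is the gradient of the expected loss
  minus that of the regularizer.\<close>

definition mean_backprop :: "real ^ 'p \<Rightarrow> real ^ 'p" where
  "mean_backprop u = (\<integral>x'. backprop x' u \<partial>distr M borel x)"

lemma integrable_backprop: "integrable (distr M borel x) (\<lambda>x'. backprop x' u)"
proof -
  interpret X: prob_space "distr M borel x" by (rule prob_space_distr) (rule sample)
  show ?thesis
    by (rule X.integrable_const_bound[where B = "grad_bound 0"])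
       (auto intro!: norm_backprop_le measurable_backprop)
qed

lemma norm_mean_backprop_le: "norm (mean_backprop u) \<le> grad_bound c"
proof -
  interpret X: prob_space "distr M borel x" by (rule prob_space_distr) (rule sample)
  have "norm (mean_backprop u) \<le> (\<integral>x'. norm (backprop x' u) \<partial>distr M borel x)"
    unfolding mean_backprop_def by (rule integral_norm_bound)
  also have "\<dots> \<le> (\<integral>x'. grad_bound c \<partial>distr M borel x)"
    by (intro integral_mono integrable_norm integrable_backprop norm_backprop_le c_nonneg) simp
  finally show ?thesis using X.prob_space by simp
qed

lemma measurable_mean_backprop: "mean_backprop \<in> borel_measurable borel"
proof -
  interpret X: prob_space "distr M borel x" by (rule prob_space_distr) (rule sample)
  show ?thesis
    unfolding mean_backprop_def[abs_def]
    by (intro X.borel_measurable_lebesgue_integral) (simp add: split_beta' measurable_backprop)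
qed

text \<open>Sample and weights have a product law, so Fubini allows integrating over the sample
  first. At fixed weights \<open>u\<close> the mean of \<open>backprop\<close> cancels against
  \<open>mean_backprop u\<close>.\<close>

lemma sampling_noise_orthogonal:
  assumes a: "a \<in> borel_measurable borel" and le: "AE \<omega> in M. norm (a (w \<omega>)) \<le> b"
  shows "(\<integral>\<omega>. a (w \<omega>) \<bullet> (backprop (x \<omega>) (w \<omega>) - mean_backprop (w \<omega>)) \<partial>M) = 0"
proof -
  let ?X = "distr M borel x" and ?W = "distr M borel w"
  let ?g = "\<lambda>x' u. a u \<bullet> (backprop x' u - mean_backprop u)"
  note [measurable] = sample(1) measurable_weights a measurable_mean_backprop
  interpret X: prob_space ?X by (rule prob_space_distr) simp
  interpret W: prob_space ?W by (rule prob_space_distr) simp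
  interpret XW: pair_sigma_finite ?X ?W ..
  have pair: "?X \<Otimes>\<^sub>M ?W = distr M (borel \<Otimes>\<^sub>M borel) (\<lambda>\<omega>. (x \<omega>, w \<omega>))"
    by (rule distr_Pair_indep_set[OF past sample])
  have g: "case_prod ?g \<in> borel_measurable (borel \<Otimes>\<^sub>M borel)"
    unfolding split_beta'
    by (intro borel_measurable_inner borel_measurable_diff measurable_backprop
        measurable_compose[OF measurable_snd]) auto
  have noise_le: "AE \<omega> in M. norm (backprop (x \<omega>) (w \<omega>) - mean_backprop (w \<omega>))
      \<le> grad_bound c + grad_bound c"
    by (intro AE_I2 norm_triangle_le_diff add_mono norm_backprop_le norm_mean_backprop_le c_nonneg)
  have int: "integrable M (\<lambda>\<omega>. ?g (x \<omega>) (w \<omega>))"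
    by (rule integrable_inner_AE_bounded[OF _ _ le noise_le])
       (measurable, intro borel_measurable_diff measurable_backprop, measurable)
  have "(\<integral>\<omega>. ?g (x \<omega>) (w \<omega>) \<partial>M) = integral\<^sup>L (?X \<Otimes>\<^sub>M ?W) (case_prod ?g)"
    unfolding pair using g by (subst integral_distr) auto
  also have "\<dots> = (\<integral>u. (\<integral>x'. ?g x' u \<partial>?X) \<partial>?W)"
  proof (rule XW.integral_snd[symmetric])
    show "integrable (?X \<Otimes>\<^sub>M ?W) (case_prod ?g)"
      unfolding pair using g int by (subst integrable_distr_eq) auto
  qed
  also have "\<dots> = 0"
    using integrable_backprop X.prob_space by (simp add: mean_backprop_def)
  finally show ?thesis .
qed

end

section \<open>Descent in one iteration\<close>

text \<open>Here \<open>n\<close> is the sampling noise, \<open>b\<close> the forward bias and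
  \<open>e\<close> the backward noise. Of the first-order gain, \<open>\<gamma>\<close> times the
  squared gradient norm, one quarter pays for Young's inequality on \<open>b\<close> and one quarter
  for the gradient part of the second-order term, by \<open>8 * L * \<gamma> \<le> 1\<close>. The
  inner products with \<open>n\<close> and \<open>e\<close> are kept, because their means
  vanish.\<close>

lemma descent_step:
  fixes l :: "real ^ 'p::finite \<Rightarrow> real"
  assumes diff: "\<And>w. l differentiable (at w)" and lip: "L-lipschitz_on UNIV (grad l)"
    and \<gamma>: "0 < \<gamma>" "8 * L * \<gamma> \<le> 1"
    and bound: "norm (n + b + e) \<le> q"
  shows "l (w - \<gamma> *\<^sub>R (grad l w + n + b + e)) \<le> l w - \<gamma> / 2 * (norm (grad l w))\<^sup>2
    + \<gamma> * (norm b)\<^sup>2 + 2 * L * \<gamma>\<^sup>2 * q\<^sup>2 - \<gamma> * (grad l w \<bullet> n) - \<gamma> * (grad l w \<bullet> e)"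
proof -
  let ?g = "grad l w"
  let ?r = "n + b + e"
  have L: "0 \<le> L" by (rule lipschitz_on_nonneg[OF lip])
  \<comment> \<open>Parallelogram law; dropping the square of the difference separates gradient and
    error.\<close>
  have "(norm (?g + ?r))\<^sup>2 = 2 * (norm ?g)\<^sup>2 + 2 * (norm ?r)\<^sup>2 - (norm (?g - ?r))\<^sup>2"
    unfolding power2_norm_eq_inner
    by (simp only: inner_diff_left inner_diff_right inner_add_left[of ?g ?r]
        inner_add_right[of _ ?g ?r] inner_commute[of ?r ?g])
  then have "(norm (?g + ?r))\<^sup>2 \<le> 2 * (norm ?g)\<^sup>2 + 2 * (norm ?r)\<^sup>2" by simp
  also have "\<dots> \<le> 2 * (norm ?g)\<^sup>2 + 2 * q\<^sup>2"
    using bound by (simp add: power_mono)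
  finally have "L * \<gamma>\<^sup>2 * (norm (?g + ?r))\<^sup>2 \<le> L * \<gamma>\<^sup>2 * (2 * (norm ?g)\<^sup>2 + 2 * q\<^sup>2)"
    using L by (intro mult_left_mono) auto
  also have "\<dots> = (8 * L * \<gamma>) * (\<gamma> / 4 * (norm ?g)\<^sup>2) + 2 * L * \<gamma>\<^sup>2 * q\<^sup>2"
    by (simp add: power2_eq_square algebra_simps)
  also have "\<dots> \<le> \<gamma> / 4 * (norm ?g)\<^sup>2 + 2 * L * \<gamma>\<^sup>2 * q\<^sup>2"
    using \<gamma> L by (intro add_right_mono mult_left_le_one_le) auto
  finally have 1: "L * (norm (\<gamma> *\<^sub>R (?g + ?r)))\<^sup>2 \<le> \<gamma> / 4 * (norm ?g)\<^sup>2 + 2 * L * \<gamma>\<^sup>2 * q\<^sup>2"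
    by (simp add: power_mult_distrib ac_simps)
  \<comment> \<open>Young's inequality by expanding a square; the weight 1/2 produces the
    coefficient 1/4 of the gradient term.\<close>
  have "0 \<le> (norm ((1 / 2) *\<^sub>R ?g + b))\<^sup>2" by simp
  also have "\<dots> = (norm ?g)\<^sup>2 / 4 + ?g \<bullet> b + (norm b)\<^sup>2"
    by (simp add: power2_norm_eq_inner inner_add_left inner_add_right inner_commute[of b ?g] field_simps)
  finally have "\<gamma> * (- (?g \<bullet> b)) \<le> \<gamma> * ((norm ?g)\<^sup>2 / 4 + (norm b)\<^sup>2)"
    using \<gamma> by (intro mult_left_mono) auto
  moreover have "(\<gamma> *\<^sub>R (?g + ?r)) \<bullet> ?g = \<gamma> * ((norm ?g)\<^sup>2 + ?g \<bullet> n + ?g \<bullet> b + ?g \<bullet> e)"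
    by (simp add: inner_add_left inner_commute[of n ?g] inner_commute[of b ?g]
        inner_commute[of e ?g] power2_norm_eq_inner add.assoc)
  moreover have "l (w - \<gamma> *\<^sub>R (?g + ?r)) \<le>
      l w - (\<gamma> *\<^sub>R (?g + ?r)) \<bullet> ?g + L * (norm (\<gamma> *\<^sub>R (?g + ?r)))\<^sup>2"
    using smooth_upper_bound[OF diff lip, of w "- \<gamma> *\<^sub>R (?g + ?r)"] by simp
  ultimately have "l (w - \<gamma> *\<^sub>R (?g + ?r)) \<le> l w - \<gamma> / 2 * (norm ?g)\<^sup>2
      + \<gamma> * (norm b)\<^sup>2 + 2 * L * \<gamma>\<^sup>2 * q\<^sup>2 - \<gamma> * (?g \<bullet> n) - \<gamma> * (?g \<bullet> e)"
    using 1 by (simp add: algebra_simps)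
  then show ?thesis by (simp add: add.assoc)
qed

lemma (in prob_space) integrable_continuous_AE_bounded:
  fixes g :: "'b::euclidean_space \<Rightarrow> real"
  assumes "continuous_on UNIV g" "u \<in> borel_measurable M" "AE \<omega> in M. norm (u \<omega>) \<le> B"
  shows "integrable M (\<lambda>\<omega>. g (u \<omega>))"
proof -
  have "compact (g ` cball 0 B)"
    using assms(1) by (intro compact_continuous_image) (auto intro: continuous_on_subset)
  then obtain K where K: "\<And>z. z \<in> cball 0 B \<Longrightarrow> norm (g z) \<le> K"
    by (meson bounded_iff compact_imp_bounded imageI)
  show ?thesis
  proof (rule integrable_const_bound[where B = K])
    show "AE \<omega> in M. norm (g (u \<omega>)) \<le> K"
      using assms(3) by eventually_elim (simp add: K flip: real_norm_def)
  qed (rule borel_measurable_continuous_on[OF assms(1,2)])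
qed

context perturbed_step
begin

definition noisy_gradient :: "'o \<Rightarrow> real ^ 'p" where
  "noisy_gradient \<omega> = (\<Sum>i=1..N. pert_grad N out f (w \<omega>) (x \<omega>) (\<lambda>j. \<delta> j \<omega>) (\<lambda>j. \<epsilon> j \<omega>) i)"

text \<open>Forward values enter the gradients nonlinearly, so even a zero-mean forward perturbation
  leaves a bias in general; only the size of this term is controlled.\<close>

definition forward_bias :: "'o \<Rightarrow> real ^ 'p" where
  "forward_bias \<omega> = (\<Sum>i=1..N. pert_grad N out f (w \<omega>) (x \<omega>) (\<lambda>j. \<delta> j \<omega>) (\<lambda>_. 0) i)
     - backprop (x \<omega>) (w \<omega>)"

lemma measurable_noisy_gradient: "noisy_gradient \<in> borel_measurable M"
  unfolding noisy_gradient_def[abs_def]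
  by (intro borel_measurable_sum measurable_pert_grad measurable_weights sample measurable_noise)

lemma measurable_forward_bias: "forward_bias \<in> borel_measurable M"
  unfolding forward_bias_def[abs_def]
  by (intro borel_measurable_diff borel_measurable_sum measurable_pert_grad measurable_backprop
      measurable_weights sample measurable_noise) auto

lemma norm_forward_bias_le: "norm (forward_bias \<omega>) \<le> 2 * grad_bound c"
proof -
  have "norm (forward_bias \<omega>) \<le> grad_bound c + grad_bound c"
    unfolding forward_bias_def
    by (intro norm_triangle_le_diff add_mono norm_sum_pert_grad_le norm_backprop_le)
       (simp_all add: c_nonneg)
  then show ?thesis by simp
qed

lemma AE_norm_noisy_gradient_le: "AE \<omega> in M. norm (noisy_gradient \<omega>) \<le> grad_bound c"
  using bwd_noise_le
  by eventually_elim (unfold noisy_gradient_def, rule norm_sum_pert_grad_le; simp add: c_nonneg)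

text \<open>Integrates \<open>descent_step\<close>; both inner products drop out because the
  gradient at the current weights is determined by the past. The difference of \<open>grad l\<close>
  and \<open>mean_backprop\<close> in the update stands for the gradient of the regularizer.
  Boundedness of \<open>w'\<close> is among the conclusions so that the lemma can be
  iterated.\<close>

lemma expected_descent:
  fixes l :: "real ^ 'p \<Rightarrow> real"
  assumes diff: "\<And>u. l differentiable (at u)" and lip: "L-lipschitz_on UNIV (grad l)"
    and \<gamma>: "0 < \<gamma>" "8 * L * \<gamma> \<le> 1"
    and le: "AE \<omega> in M. norm (w \<omega>) \<le> B"
    and w': "\<And>\<omega>. w' \<omega> = w \<omega> - \<gamma> *\<^sub>R (noisy_gradient \<omega> + (grad l (w \<omega>) - mean_backprop (w \<omega>)))"
  shows "w' \<in> borel_measurable M"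
    and "\<exists>B'. AE \<omega> in M. norm (w' \<omega>) \<le> B'"
    and "integrable M (\<lambda>\<omega>. (norm (grad l (w \<omega>)))\<^sup>2)"
    and "integrable M (\<lambda>\<omega>. (norm (forward_bias \<omega>))\<^sup>2)"
    and "(\<integral>\<omega>. l (w' \<omega>) \<partial>M) \<le> (\<integral>\<omega>. l (w \<omega>) \<partial>M)
      - \<gamma> / 2 * (\<integral>\<omega>. (norm (grad l (w \<omega>)))\<^sup>2 \<partial>M)
      + \<gamma> * (\<integral>\<omega>. (norm (forward_bias \<omega>))\<^sup>2 \<partial>M) + 8 * L * \<gamma>\<^sup>2 * (grad_bound c)\<^sup>2"
proof -
  let ?g = "\<lambda>\<omega>. grad l (w \<omega>)"
  let ?n = "\<lambda>\<omega>. backprop (x \<omega>) (w \<omega>) - mean_backprop (w \<omega>)"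
  let ?b = forward_bias
  let ?e = "\<lambda>\<omega>. noisy_gradient \<omega>
    - (\<Sum>i=1..N. pert_grad N out f (w \<omega>) (x \<omega>) (\<lambda>j. \<delta> j \<omega>) (\<lambda>_. 0) i)"
  \<comment> \<open>Lipschitz bound for the gradient on the ball of radius \<open>B\<close>.\<close>
  define G where "G = norm (grad l 0) + L * B"
  have cont_g: "continuous_on UNIV (grad l)"
    by (rule lipschitz_on_continuous_on[OF lip])
  have cont_l: "continuous_on UNIV l"
    using diff by (auto intro!: continuous_at_imp_continuous_on differentiable_imp_continuous_within)
  note w = measurable_weights
  have g: "?g \<in> borel_measurable M" and n: "?n \<in> borel_measurable M"
    and b: "?b \<in> borel_measurable M" and e: "?e \<in> borel_measurable M"
    by (intro borel_measurable_continuous_on[OF cont_g] w borel_measurable_diff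
        measurable_backprop sample measurable_compose[OF _ measurable_mean_backprop]
        measurable_forward_bias measurable_noisy_gradient borel_measurable_sum
        measurable_pert_grad measurable_noise borel_measurable_const; simp)+
  have g_le: "AE \<omega> in M. norm (?g \<omega>) \<le> G"
    using le
  proof eventually_elim
    case (elim \<omega>)
    have "norm (?g \<omega>) \<le> norm (grad l 0) + norm (?g \<omega> - grad l 0)"
      by (metis norm_triangle_sub)
    also have "norm (?g \<omega> - grad l 0) \<le> L * norm (w \<omega>)"
      using lipschitz_onD[OF lip, of "w \<omega>" 0] by (simp add: dist_norm)
    also have "\<dots> \<le> L * B"
      using elim lipschitz_on_nonneg[OF lip] by (rule mult_left_mono)
    finally show ?case by (simp add: G_def)
  qed
  show w'_meas: "w' \<in> borel_measurable M"
    unfolding w'[abs_def]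
    by (intro borel_measurable_diff borel_measurable_scaleR borel_measurable_add w g
        measurable_noisy_gradient measurable_compose[OF _ measurable_mean_backprop]
        borel_measurable_const)
  \<comment> \<open>The three errors telescope to a difference of two vectors of size at most
    \<open>grad_bound c\<close>. Squaring the resulting factor 2 turns \<open>2 * L\<close> into
    \<open>8 * L\<close>.\<close>
  have dev_le: "AE \<omega> in M. norm (?n \<omega> + ?b \<omega> + ?e \<omega>) \<le> 2 * grad_bound c"
    using AE_norm_noisy_gradient_le
  proof eventually_elim
    case (elim \<omega>)
    have eq: "?n \<omega> + ?b \<omega> + ?e \<omega> = noisy_gradient \<omega> - mean_backprop (w \<omega>)"
      by (simp add: forward_bias_def)
    show ?case
      unfolding eq
      using norm_triangle_le_diff[OF add_mono[OF elim norm_mean_backprop_le[of "w \<omega>"]]] by simp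
  qed
  have w'_eq: "w' \<omega> = w \<omega> - \<gamma> *\<^sub>R (?g \<omega> + ?n \<omega> + ?b \<omega> + ?e \<omega>)" for \<omega>
    by (simp add: w' forward_bias_def)
  have w'_le: "AE \<omega> in M. norm (w' \<omega>) \<le> B + \<gamma> * (G + 2 * grad_bound c)"
    using le g_le dev_le
  proof eventually_elim
    case (elim \<omega>)
    have "norm (?g \<omega> + ?n \<omega> + ?b \<omega> + ?e \<omega>) \<le> G + 2 * grad_bound c"
      using norm_triangle_le[OF add_mono[OF elim(2,3)]] by (simp only: add.assoc)
    then show ?case
      unfolding w'_eq using \<gamma>(1)
      by (intro norm_triangle_le_diff add_mono elim) (simp add: mult_left_mono)
  qed
  then show "\<exists>B'. AE \<omega> in M. norm (w' \<omega>) \<le> B'" by blast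
  have n_le: "AE \<omega> in M. norm (?n \<omega>) \<le> grad_bound c + grad_bound c"
    by (intro AE_I2 norm_triangle_le_diff add_mono norm_backprop_le norm_mean_backprop_le c_nonneg)
  have e_le: "AE \<omega> in M. norm (?e \<omega>) \<le> grad_bound c + grad_bound c"
    using AE_norm_noisy_gradient_le
    by eventually_elim
       (intro norm_triangle_le_diff add_mono norm_sum_pert_grad_le; simp add: c_nonneg)
  have b_le: "AE \<omega> in M. norm (?b \<omega>) \<le> 2 * grad_bound c"
    by (intro AE_I2 norm_forward_bias_le)
  have int_g: "integrable M (\<lambda>\<omega>. (norm (?g \<omega>))\<^sup>2)"
    using integrable_inner_AE_bounded[OF g g g_le g_le] by (simp add: power2_norm_eq_inner)
  then show "integrable M (\<lambda>\<omega>. (norm (grad l (w \<omega>)))\<^sup>2)" .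
  have int_b: "integrable M (\<lambda>\<omega>. (norm (?b \<omega>))\<^sup>2)"
    using integrable_inner_AE_bounded[OF b b b_le b_le] by (simp add: power2_norm_eq_inner)
  then show "integrable M (\<lambda>\<omega>. (norm (forward_bias \<omega>))\<^sup>2)" .
  have int_n: "integrable M (\<lambda>\<omega>. ?g \<omega> \<bullet> ?n \<omega>)"
    by (rule integrable_inner_AE_bounded[OF g n g_le n_le])
  have int_e: "integrable M (\<lambda>\<omega>. ?g \<omega> \<bullet> ?e \<omega>)"
    by (rule integrable_inner_AE_bounded[OF g e g_le e_le])
  have int_l: "integrable M (\<lambda>\<omega>. l (w \<omega>))" "integrable M (\<lambda>\<omega>. l (w' \<omega>))"
    using integrable_continuous_AE_bounded[OF cont_l w le]
      integrable_continuous_AE_bounded[OF cont_l w'_meas w'_le] by auto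
  have zero_n: "(\<integral>\<omega>. ?g \<omega> \<bullet> ?n \<omega> \<partial>M) = 0"
    using g_le by (intro sampling_noise_orthogonal borel_measurable_continuous_onI cont_g)
  have zero_e: "(\<integral>\<omega>. ?g \<omega> \<bullet> ?e \<omega> \<partial>M) = 0"
    unfolding noisy_gradient_def
    by (rule gradient_noise_orthogonal[OF borel_measurable_continuous_on[OF cont_g] g_le])
       (rule measurable_known)
  have "(\<integral>\<omega>. l (w' \<omega>) \<partial>M) \<le> (\<integral>\<omega>. l (w \<omega>) - \<gamma> / 2 * (norm (?g \<omega>))\<^sup>2 + \<gamma> * (norm (?b \<omega>))\<^sup>2
      + 2 * L * \<gamma>\<^sup>2 * (2 * grad_bound c)\<^sup>2 - \<gamma> * (?g \<omega> \<bullet> ?n \<omega>) - \<gamma> * (?g \<omega> \<bullet> ?e \<omega>) \<partial>M)"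
  proof (rule integral_mono_AE)
    show "AE \<omega> in M. l (w' \<omega>) \<le> l (w \<omega>) - \<gamma> / 2 * (norm (?g \<omega>))\<^sup>2 + \<gamma> * (norm (?b \<omega>))\<^sup>2
        + 2 * L * \<gamma>\<^sup>2 * (2 * grad_bound c)\<^sup>2 - \<gamma> * (?g \<omega> \<bullet> ?n \<omega>) - \<gamma> * (?g \<omega> \<bullet> ?e \<omega>)"
      using dev_le unfolding w'_eq by eventually_elim (rule descent_step[OF diff lip \<gamma>])
  qed (intro int_l Bochner_Integration.integrable_diff Bochner_Integration.integrable_add
      integrable_mult_right int_g int_b int_n int_e integrable_const)+
  also have "\<dots> = (\<integral>\<omega>. l (w \<omega>) \<partial>M) - \<gamma> / 2 * (\<integral>\<omega>. (norm (?g \<omega>))\<^sup>2 \<partial>M)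
      + \<gamma> * (\<integral>\<omega>. (norm (?b \<omega>))\<^sup>2 \<partial>M) + 2 * L * \<gamma>\<^sup>2 * (2 * grad_bound c)\<^sup>2"
    using int_l int_g int_b int_n int_e zero_n zero_e by (simp add: prob_space)
  finally show "(\<integral>\<omega>. l (w' \<omega>) \<partial>M) \<le> (\<integral>\<omega>. l (w \<omega>) \<partial>M)
      - \<gamma> / 2 * (\<integral>\<omega>. (norm (grad l (w \<omega>)))\<^sup>2 \<partial>M)
      + \<gamma> * (\<integral>\<omega>. (norm (forward_bias \<omega>))\<^sup>2 \<partial>M) + 8 * L * \<gamma>\<^sup>2 * (grad_bound c)\<^sup>2"
    by (simp add: power2_eq_square)
qed

end

section \<open>Summation over a run\<close>

text \<open>The expected losses telescope, and the last one is at least \<open>m\<close>. The bias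
  is bounded through its sum along a path, since the number of perturbed iterations is limited but
  not their times.\<close>

lemma (in layered_network) summed_gradient_bound:
  fixes l R :: "real ^ 'p \<Rightarrow> real" and M :: "'o measure"
  defines "bias \<equiv> \<lambda>w x \<delta>. (\<Sum>i=1..N. pert_grad N out f w x \<delta> (\<lambda>_. 0) i) - backprop x w"
  assumes M: "prob_space M"
    and step: "\<And>t. t < T \<Longrightarrow> perturbed_step N out f C M (F t) (w t) (x t) (\<delta> t) (\<epsilon> t) c"
    and diff: "\<And>u. l differentiable (at u)" and lip: "L-lipschitz_on UNIV (grad l)"
    and \<gamma>: "0 < \<gamma>" "8 * L * \<gamma> \<le> 1"
    and minimum: "\<And>u. m \<le> l u"
    and init: "\<And>\<omega>. w 0 \<omega> = w0"
    and update: "\<And>t \<omega>. t < T \<Longrightarrow> w (Suc t) \<omega> = w t \<omega> - \<gamma> *\<^sub>R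
      ((\<Sum>i=1..N. pert_grad N out f (w t \<omega>) (x t \<omega>) (\<lambda>i. \<delta> t i \<omega>) (\<lambda>i. \<epsilon> t i \<omega>) i) + grad R (w t \<omega>))"
    and mean: "\<And>t u. t < T \<Longrightarrow>
      grad l u = (\<integral>x'. backprop x' u \<partial>distr M borel (x t)) + grad R u"
    and bias: "AE \<omega> in M. (\<Sum>t<T. (norm (bias (w t \<omega>) (x t \<omega>) (\<lambda>i. \<delta> t i \<omega>)))\<^sup>2) \<le> q"
  shows "\<And>t. t < T \<Longrightarrow> integrable M (\<lambda>\<omega>. (norm (grad l (w t \<omega>)))\<^sup>2)"
    and "\<gamma> / 2 * (\<Sum>t<T. \<integral>\<omega>. (norm (grad l (w t \<omega>)))\<^sup>2 \<partial>M)
      \<le> l w0 - m + \<gamma> * q + real T * (8 * L * \<gamma>\<^sup>2 * (grad_bound c)\<^sup>2)"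
proof -
  interpret prob_space M by (rule M)
  let ?G = "\<lambda>t. \<integral>\<omega>. (norm (grad l (w t \<omega>)))\<^sup>2 \<partial>M"
  let ?b = "\<lambda>t \<omega>. (norm (bias (w t \<omega>) (x t \<omega>) (\<lambda>i. \<delta> t i \<omega>)))\<^sup>2"
  have descent: "w (Suc t) \<in> borel_measurable M" "\<exists>B'. AE \<omega> in M. norm (w (Suc t) \<omega>) \<le> B'"
      "integrable M (\<lambda>\<omega>. (norm (grad l (w t \<omega>)))\<^sup>2)" "integrable M (?b t)"
      "(\<integral>\<omega>. l (w (Suc t) \<omega>) \<partial>M) \<le> (\<integral>\<omega>. l (w t \<omega>) \<partial>M) - \<gamma> / 2 * ?G t
        + \<gamma> * (\<integral>\<omega>. ?b t \<omega> \<partial>M) + 8 * L * \<gamma>\<^sup>2 * (grad_bound c)\<^sup>2"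
    if t: "t < T" and B: "AE \<omega> in M. norm (w t \<omega>) \<le> B" for t B
  proof -
    interpret S: perturbed_step N out f C M "F t" "w t" "x t" "\<delta> t" "\<epsilon> t" c
      by (rule step[OF t])
    have "w (Suc t) \<omega> = w t \<omega> - \<gamma> *\<^sub>R
        (S.noisy_gradient \<omega> + (grad l (w t \<omega>) - S.mean_backprop (w t \<omega>)))" for \<omega>
      using update[OF t, of \<omega>] mean[OF t, of "w t \<omega>"]
      by (simp add: S.noisy_gradient_def S.mean_backprop_def)
    note D = S.expected_descent[OF diff lip \<gamma> B this, unfolded S.forward_bias_def[abs_def]]
    show "w (Suc t) \<in> borel_measurable M" "\<exists>B'. AE \<omega> in M. norm (w (Suc t) \<omega>) \<le> B'"
      "integrable M (\<lambda>\<omega>. (norm (grad l (w t \<omega>)))\<^sup>2)"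
      by (fact D(1-3))+
    show "integrable M (?b t)"
      unfolding bias_def by (fact D(4))
    show "(\<integral>\<omega>. l (w (Suc t) \<omega>) \<partial>M) \<le> (\<integral>\<omega>. l (w t \<omega>) \<partial>M) - \<gamma> / 2 * ?G t
        + \<gamma> * (\<integral>\<omega>. ?b t \<omega> \<partial>M) + 8 * L * \<gamma>\<^sup>2 * (grad_bound c)\<^sup>2"
      unfolding bias_def by (fact D(5))
  qed
  \<comment> \<open>The bound may grow from step to step, but the start is deterministic and the
    horizon finite.\<close>
  have bounded: "w t \<in> borel_measurable M \<and> (\<exists>B. AE \<omega> in M. norm (w t \<omega>) \<le> B)" if "t \<le> T" for t
    using that
  proof (induction t)
    case 0
    have "w 0 = (\<lambda>_. w0)" by (rule ext) (rule init)
    then show ?case by auto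
  next
    case (Suc t)
    then show ?case using descent(1,2)[of t] by auto
  qed
  show int_g: "integrable M (\<lambda>\<omega>. (norm (grad l (w t \<omega>)))\<^sup>2)" if "t < T" for t
    using bounded[of t] descent(3)[OF that] that by auto
  have int_b: "integrable M (?b t)" if "t < T" for t
    using bounded[of t] descent(4)[OF that] that by auto
  have "(\<integral>\<omega>. l (w n \<omega>) \<partial>M) + \<gamma> / 2 * (\<Sum>t<n. ?G t)
      \<le> l w0 + \<gamma> * (\<Sum>t<n. \<integral>\<omega>. ?b t \<omega> \<partial>M) + real n * (8 * L * \<gamma>\<^sup>2 * (grad_bound c)\<^sup>2)"
    if "n \<le> T" for n
    using that
  proof (induction n)
    case 0
    then show ?case by (simp add: init prob_space)
  next
    case (Suc n)
    then show ?case
      using bounded[of n] descent(5)[of n] by (fastforce simp: algebra_simps)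
  qed
  from this[of T] have "(\<integral>\<omega>. l (w T \<omega>) \<partial>M) + \<gamma> / 2 * (\<Sum>t<T. ?G t)
      \<le> l w0 + \<gamma> * (\<Sum>t<T. \<integral>\<omega>. ?b t \<omega> \<partial>M) + real T * (8 * L * \<gamma>\<^sup>2 * (grad_bound c)\<^sup>2)"
    by simp
  moreover have "m \<le> (\<integral>\<omega>. l (w T \<omega>) \<partial>M)"
  proof -
    have "continuous_on UNIV l"
      using diff by (auto intro!: continuous_at_imp_continuous_on differentiable_imp_continuous_within)
    then have "integrable M (\<lambda>\<omega>. l (w T \<omega>))"
      using bounded[of T] by (auto intro: integrable_continuous_AE_bounded)
    then have "(\<integral>\<omega>. m \<partial>M) \<le> (\<integral>\<omega>. l (w T \<omega>) \<partial>M)"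
      by (intro integral_mono minimum) simp_all
    then show ?thesis by (simp add: prob_space)
  qed
  moreover have "\<gamma> * (\<Sum>t<T. \<integral>\<omega>. ?b t \<omega> \<partial>M) \<le> \<gamma> * q"
  proof -
    have "(\<Sum>t<T. \<integral>\<omega>. ?b t \<omega> \<partial>M) = (\<integral>\<omega>. (\<Sum>t<T. ?b t \<omega>) \<partial>M)"
      using int_b by (intro Bochner_Integration.integral_sum[symmetric]) auto
    also have "\<dots> \<le> (\<integral>\<omega>. q \<partial>M)"
      using int_b bias by (intro integral_mono_AE Bochner_Integration.integrable_sum) auto
    finally show ?thesis using \<gamma> by (simp add: prob_space)
  qed
  ultimately show "\<gamma> / 2 * (\<Sum>t<T. ?G t)
      \<le> l w0 - m + \<gamma> * q + real T * (8 * L * \<gamma>\<^sup>2 * (grad_bound c)\<^sup>2)"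
    by linarith
qed

text \<open>
  Perturbations of bounded size need not be small, so the bias is only charged to the iterations
  in which a forward perturbation occurs at all.
\<close>

lemma (in layered_network) sum_bias_le_occurrences:
  assumes "intermittent c T {1..N} occ \<delta> \<omega>" "0 \<le> c"
  shows "(\<Sum>t<T. (norm ((\<Sum>i=1..N. pert_grad N out f (w t) (x t) (\<lambda>i. \<delta> t i \<omega>) (\<lambda>_. 0) i)
      - backprop (x t) (w t)))\<^sup>2)
    \<le> 4 * (grad_bound c)\<^sup>2 * real (occurrences T {1..N} occ \<omega>)"
proof -
  let ?b = "\<lambda>t. (\<Sum>i=1..N. pert_grad N out f (w t) (x t) (\<lambda>i. \<delta> t i \<omega>) (\<lambda>_. 0) i)
      - backprop (x t) (w t)"
  let ?O = "{(t, i). t < T \<and> i \<in> {1..N} \<and> occ t i \<omega>}"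
  have fin: "finite ?O" by (rule finite_subset[of _ "{..<T} \<times> {1..N}"]) auto
  \<comment> \<open>The first components of \<open>?O\<close> are the iterations with a forward
    perturbation. Several perturbed layers in one iteration are charged once, so there are at most
    as many such iterations as occurrences.\<close>
  have "(norm (?b t))\<^sup>2 \<le> 4 * (grad_bound c)\<^sup>2 * (if t \<in> fst ` ?O then 1 else 0)" if "t < T" for t
  proof (cases "t \<in> fst ` ?O")
    case True
    have "norm (?b t) \<le> grad_bound c + grad_bound c"
      by (intro norm_triangle_le_diff add_mono norm_sum_pert_grad_le norm_backprop_le assms)
         (simp_all add: assms)
    then have "(norm (?b t))\<^sup>2 \<le> (2 * grad_bound c)\<^sup>2" by (intro power_mono) simp_all
    then show ?thesis using True by (simp add: power_mult_distrib)
  next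
    case False
    then have "\<delta> t i \<omega> = 0" if "i \<in> {1..N}" for i
      using assms(1) that \<open>t < T\<close> unfolding intermittent_def by (force simp: image_iff)
    then show ?thesis by (subst pert_grad_unperturbed) auto
  qed
  then have "(\<Sum>t<T. (norm (?b t))\<^sup>2)
      \<le> (\<Sum>t<T. 4 * (grad_bound c)\<^sup>2 * (if t \<in> fst ` ?O then 1 else 0))"
    by (intro sum_mono) auto
  also have "\<dots> = 4 * (grad_bound c)\<^sup>2 * real (card ({..<T} \<inter> fst ` ?O))"
    by (simp add: sum_distrib_left[symmetric] flip: sum.inter_restrict)
  also have "\<dots> \<le> 4 * (grad_bound c)\<^sup>2 * real (card ?O)"
    using card_image_le[OF fin, of fst] card_mono[OF finite_imageI[OF fin], of "{..<T} \<inter> fst ` ?O" fst]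
    by (intro mult_left_mono) auto
  finally show ?thesis by (simp add: occurrences_def)
qed

section \<open>Reduction of a run to single iterations\<close>

text \<open>Each coordinate lies in exactly one block, so a single summand survives. This merges the
  blockwise regularizer terms of the update into one gradient.\<close>

lemma sum_coord_proj_blocks:
  assumes "disjoint_family_on W I" "(\<Union>i\<in>I. W i) = UNIV" "finite I"
  shows "(\<Sum>i\<in>I. coord_proj (W i) g) = g"
proof -
  have "(\<Sum>i\<in>I. coord_proj (W i) g) $ k = g $ k" for k
  proof -
    obtain j where j: "j \<in> I" "k \<in> W j" using assms(2) by blast
    then have "k \<in> W i \<longleftrightarrow> i = j" if "i \<in> I" for i
      using assms(1) that by (auto simp: disjoint_family_on_def)
    then show ?thesis using j assms(3) by (simp add: coord_proj_def cong: sum.cong)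
  qed
  then show ?thesis by (simp add: vec_eq_iff)
qed

lemma perturbed_step_sampling_run:
  fixes f :: "nat \<Rightarrow> ('n::finite, 'p::finite) layer"
  assumes net: "layered_network N f C" and N: "1 \<le> N" and c: "0 \<le> c"
    and run: "sampling_run N A D T M F w x \<delta> \<epsilon>" and zero: "zero_mean N out f T M F w x \<delta> \<epsilon>"
    and inter: "AE \<omega> in M. intermittent c T {2..N} occ \<epsilon> \<omega>" and t: "t < T"
  shows "perturbed_step N out f C M (F t) (w t) (x t) (\<delta> t) (\<epsilon> t) c"
proof -
  have M: "prob_space M" using run by (simp add: sampling_run_def)
  have "AE \<omega> in M. \<forall>i\<in>{2..N}. norm (\<epsilon> t i \<omega>) \<le> c"
    using inter
  proof eventually_elim
    case (elim \<omega>)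
    show ?case
    proof
      fix i assume "i \<in> {2..N}"
      then have "if occ t i \<omega> then norm (\<epsilon> t i \<omega>) \<le> c else \<epsilon> t i \<omega> = 0"
        using elim t unfolding intermittent_def by blast
      then show "norm (\<epsilon> t i \<omega>) \<le> c" using c by (auto split: if_splits)
    qed
  qed
  moreover have "cond_mean_zero M
      (adjoin M (adjoin M (F t) ((\<lambda>i \<omega>. pert_fwd f (w t \<omega>) (x t \<omega>) (\<lambda>j. \<delta> t j \<omega>) i) ` {1..N}))
        (insert (\<lambda>\<omega>. pert_fwd f (w t \<omega>) (x t \<omega>) (\<lambda>j. \<delta> t j \<omega>) 0)
          ((\<lambda>i \<omega>. pert_bwd N out f (w t \<omega>) (x t \<omega>) (\<lambda>j. \<delta> t j \<omega>) (\<lambda>j. \<epsilon> t j \<omega>) i) ` {i..N})))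
      (\<epsilon> t i)" if "i \<in> {2..N}" for i
  proof -
    \<comment> \<open>Index shift: the zero-mean condition numbers the backward perturbations
      \<open>j + 1\<close> with \<open>j\<close> from 1 to \<open>N - 1\<close>.\<close>
    obtain j where "i = j + 1" "j \<in> {1..N - 1}"
      using \<open>i \<in> {2..N}\<close> by (auto intro!: that[of "i - 1"])
    then show ?thesis using zero t unfolding zero_mean_def Let_def by blast
  qed
  ultimately show ?thesis
    using run t c
    by (intro perturbed_step.intro net M perturbed_step_axioms.intro) (auto simp: sampling_run_def)
qed

section \<open>Choice of the constants and the convergence rate\<close>

theorem corollary2:
  fixes N :: nat
    and A :: "nat \<Rightarrow> 'n::finite set"
    and W :: "nat \<Rightarrow> 'p::finite set"
    and out :: 'n
    and f :: "nat \<Rightarrow> real ^ 'n \<Rightarrow> real ^ 'p \<Rightarrow> real ^ 'n"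
    and R :: "real ^ 'p \<Rightarrow> real"
    and D :: "(real ^ 'n) measure"
    and w0 :: "real ^ 'p"
  assumes layers: "N \<ge> 2"
    and dims: "\<forall>i<N. A i \<noteq> {}" "A N = {out}"
    and blocks: "\<forall>i\<in>{1..N}. W i \<noteq> {}" "disjoint_family_on W {1..N}"
      "(\<Union>i\<in>{1..N}. W i) = UNIV"
    and operators: "\<forall>i\<in>{1..N}. padded_operator (A (i - 1)) (W i) (A i) (f i)"
      "\<forall>i\<in>{1..N}. twice_differentiable (f i)"
    and regularizer: "\<forall>w. R differentiable (at w)"
    and data: "prob_space D" "sets D = sets borel" "AE x in D. x \<in> coord_space (A 0)"
      "\<forall>w. integrable D (\<lambda>x. sample_loss N out f R x w)"
    and minimum: "\<exists>w'. \<forall>w. expected_loss N out f R D w' \<le> expected_loss N out f R D w"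
    and smoothness: "loss_smoothness (expected_loss N out f R D)"
    and stochastic: "stochasticity D (sample_loss N out f R) (expected_loss N out f R D)"
    and regularity: "operator_regularity N f"
  shows "\<forall>c>0. \<exists>K>0. \<exists>T0. \<exists>\<gamma>. (\<forall>T. \<gamma> T > 0) \<and>
    (\<forall>T\<ge>T0. \<forall>(M :: 'o measure) F w x \<delta> \<epsilon> occ_\<delta> occ_\<epsilon>.
       (\<forall>t \<omega>. w t \<omega> =
          psgd N out W f R w0 (\<gamma> T) (\<lambda>s. x s \<omega>) (\<lambda>s i. \<delta> s i \<omega>) (\<lambda>s i. \<epsilon> s i \<omega>) t) \<and>
       sampling_run N A D T M F w x \<delta> \<epsilon> \<and>
       zero_mean N out f T M F w x \<delta> \<epsilon> \<and>
       (AE \<omega> in M. intermittent c T {1..N} occ_\<delta> \<delta> \<omega> \<and> intermittent c T {2..N} occ_\<epsilon> \<epsilon> \<omega>) \<and>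
       (AE \<omega> in M. real (occurrences T {1..N} occ_\<delta> \<omega>) \<le> c * real T powr (1 / 2)) \<and>
       (AE \<omega> in M. real (occurrences T {2..N} occ_\<epsilon> \<omega>) \<le> c * real T)
       \<longrightarrow>
         (\<forall>t<T. integrable M (\<lambda>\<omega>. (norm (grad (expected_loss N out f R D) (w t \<omega>)))\<^sup>2)) \<and>
         1 / real T * (\<Sum>t<T. \<integral>\<omega>. (norm (grad (expected_loss N out f R D) (w t \<omega>)))\<^sup>2 \<partial>M)
           \<le> K * real T powr (- 1 / 2))"
proof (intro allI impI)
  fix c :: real
  assume c: "c > 0"
  let ?l = "expected_loss N out f R D"
  obtain C where C: "C > 0"
    and jac: "\<And>i y w. i \<in> {1..N} \<Longrightarrow> onorm ((*v) (jac1 (f i) y w)) \<le> C"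
      "\<And>i y w. i \<in> {1..N} \<Longrightarrow> onorm ((*v) (jac2 (f i) y w)) \<le> C"
    using regularity unfolding operator_regularity_def by blast
  interpret net: layered_network N out f C
    using operators(2) jac C by unfold_locales auto
  obtain L where diff: "\<And>u. ?l differentiable (at u)" and L: "L > 0" "L-lipschitz_on UNIV (grad ?l)"
    using smoothness unfolding loss_smoothness_def by blast
  obtain w' where w': "\<And>u. ?l w' \<le> ?l u" using minimum by blast
  interpret D: prob_space D by (rule data(1))
  \<comment> \<open>Exchanging gradient and expectation is the unbiasedness part of the
    stochasticity assumption; sample gradients are given by backpropagation.\<close>
  have grad_l: "grad ?l u = (\<integral>x. net.backprop x u \<partial>D) + grad R u" for u
  proof -
    have *: "integrable D (\<lambda>x. net.backprop x u)"
      using data(2)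
      by (intro D.integrable_const_bound[where B = "net.grad_bound 0"] AE_I2
          net.norm_backprop_le net.measurable_backprop) simp_all
    have "grad ?l u = (\<integral>x. grad (sample_loss N out f R x) u \<partial>D)"
      using stochastic unfolding stochasticity_def by metis
    also have "\<dots> = (\<integral>x. net.backprop x u + grad R u \<partial>D)"
      using regularizer by (simp add: net.grad_sample_loss)
    also have "\<dots> = (\<integral>x. net.backprop x u \<partial>D) + grad R u"
      using * by (simp add: D.prob_space)
    finally show ?thesis .
  qed
  define P where "P = net.grad_bound c"
  \<comment> \<open>The summed inequality gets multiplied by \<open>2 / \<gamma> T\<close>, which is
    \<open>16 * L * sqrt (real T)\<close>. The initial gap, the total forward bias and the
    second-order terms then become the first three summands times \<open>sqrt (real T)\<close>. The
    final 1 makes \<open>K\<close> positive.\<close>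
  define K where "K = 16 * L * (?l w0 - ?l w') + 8 * P\<^sup>2 * c + 2 * P\<^sup>2 + 1"
  \<comment> \<open>The factor \<open>8 * L\<close> ensures
    \<open>8 * L * \<gamma> T \<le> 1\<close> for \<open>T \<ge> 1\<close>. The separate value at 0
    keeps the step size positive, where the quotient would be 0.\<close>
  define \<gamma> where "\<gamma> T = (if T = 0 then 1 else 1 / (8 * L * sqrt (real T)))" for T :: nat
  have "0 \<le> 16 * L * (?l w0 - ?l w')"
    using L w'[of w0] by (intro mult_nonneg_nonneg) auto
  then have K: "K > 0"
    using c unfolding K_def by (intro add_nonneg_pos add_nonneg_nonneg) auto
  have \<gamma>_pos: "\<gamma> T > 0" for T using L by (simp add: \<gamma>_def)
  have rate: "(\<forall>t<T. integrable M (\<lambda>\<omega>. (norm (grad ?l (w t \<omega>)))\<^sup>2)) \<and>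
      1 / real T * (\<Sum>t<T. \<integral>\<omega>. (norm (grad ?l (w t \<omega>)))\<^sup>2 \<partial>M) \<le> K * real T powr (- 1 / 2)"
    if T: "T \<ge> 1"
      and w: "\<And>t \<omega>. w t \<omega> =
        psgd N out W f R w0 (\<gamma> T) (\<lambda>s. x s \<omega>) (\<lambda>s i. \<delta> s i \<omega>) (\<lambda>s i. \<epsilon> s i \<omega>) t"
      and run: "sampling_run N A D T M F w x \<delta> \<epsilon>"
      and zero: "zero_mean N out f T M F w x \<delta> \<epsilon>"
      and inter: "AE \<omega> in M. intermittent c T {1..N} occ\<^sub>1 \<delta> \<omega> \<and> intermittent c T {2..N} occ\<^sub>2 \<epsilon> \<omega>"
      and occ: "AE \<omega> in M. real (occurrences T {1..N} occ\<^sub>1 \<omega>) \<le> c * real T powr (1 / 2)"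
    for T and M :: "'o measure" and F w x \<delta> \<epsilon> occ\<^sub>1 occ\<^sub>2
  proof -
    let ?s = "sqrt (real T)"
    let ?S = "\<Sum>t<T. \<integral>\<omega>. (norm (grad ?l (w t \<omega>)))\<^sup>2 \<partial>M"
    have s: "?s \<ge> 1" "?s * ?s = real T" using T by auto
    have \<gamma>: "\<gamma> T = 1 / (8 * L * ?s)" using T by (simp add: \<gamma>_def)
    have M: "prob_space M" using run by (simp add: sampling_run_def)
    have step: "perturbed_step N out f C M (F t) (w t) (x t) (\<delta> t) (\<epsilon> t) c" if "t < T" for t
    proof (rule perturbed_step_sampling_run[OF net.layered_network_axioms _ _ run zero _ that])
      show "AE \<omega> in M. intermittent c T {2..N} occ\<^sub>2 \<epsilon> \<omega>" using inter by auto
    qed (use layers c in auto)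
    have update: "w (Suc t) \<omega> = w t \<omega> - \<gamma> T *\<^sub>R
        ((\<Sum>i=1..N. pert_grad N out f (w t \<omega>) (x t \<omega>) (\<lambda>i. \<delta> t i \<omega>) (\<lambda>i. \<epsilon> t i \<omega>) i)
         + grad R (w t \<omega>))" for t \<omega>
      unfolding w psgd.simps Let_def sum.distrib
      by (simp only: sum_coord_proj_blocks[OF blocks(2,3) finite_atLeastAtMost])
    have mean: "grad ?l u = (\<integral>x'. net.backprop x' u \<partial>distr M borel (x t)) + grad R u" if "t < T" for t u
      using grad_l run that by (simp add: sampling_run_def)
    have bias: "AE \<omega> in M. (\<Sum>t<T. (norm ((\<Sum>i=1..N.
        pert_grad N out f (w t \<omega>) (x t \<omega>) (\<lambda>i. \<delta> t i \<omega>) (\<lambda>_. 0) i)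
        - net.backprop (x t \<omega>) (w t \<omega>)))\<^sup>2) \<le> 4 * P\<^sup>2 * (c * ?s)"
      using inter occ
    proof eventually_elim
      case (elim \<omega>)
      have "4 * P\<^sup>2 * real (occurrences T {1..N} occ\<^sub>1 \<omega>) \<le> 4 * P\<^sup>2 * (c * ?s)"
        using elim(2) by (intro mult_left_mono) (auto simp: powr_half_sqrt)
      moreover have "intermittent c T {1..N} occ\<^sub>1 \<delta> \<omega>" using elim(1) by simp
      ultimately show ?case
        using net.sum_bias_le_occurrences[of c T occ\<^sub>1 \<delta> \<omega> "\<lambda>t. w t \<omega>" "\<lambda>t. x t \<omega>"] c
        unfolding P_def by linarith
    qed
    have small: "8 * L * \<gamma> T \<le> 1" using L s by (simp add: \<gamma> field_simps)
    have "w 0 \<omega> = w0" for \<omega> by (simp add: w)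
    note summed = net.summed_gradient_bound[OF M step diff L(2) \<gamma>_pos small w' this update mean bias,
        folded P_def]
    have "\<gamma> T / 2 * ?S \<le> ?l w0 - ?l w' + \<gamma> T * (4 * P\<^sup>2 * (c * ?s))
        + real T * (8 * L * (\<gamma> T)\<^sup>2 * P\<^sup>2)"
      by (rule summed(2))
    \<comment> \<open>Multiplication by \<open>2 / \<gamma> T\<close> normalizes the left-hand side
      to \<open>?S\<close>; with \<open>real T\<close> written as \<open>?s * ?s\<close>, the
      right-hand side is rational in \<open>?s\<close>.\<close>
    then have "16 * L * ?s * (\<gamma> T / 2 * ?S) \<le> 16 * L * ?s * (?l w0 - ?l w'
        + \<gamma> T * (4 * P\<^sup>2 * (c * ?s)) + (?s * ?s) * (8 * L * (\<gamma> T)\<^sup>2 * P\<^sup>2))"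
      unfolding s(2) using L s by (intro mult_left_mono) auto
    also have "16 * L * ?s * (\<gamma> T / 2 * ?S) = ?S"
      using L s(1) by (simp add: \<gamma>)
    also have "16 * L * ?s * (?l w0 - ?l w' + \<gamma> T * (4 * P\<^sup>2 * (c * ?s))
        + (?s * ?s) * (8 * L * (\<gamma> T)\<^sup>2 * P\<^sup>2)) = ?s * (K - 1)"
      using L s(1) by (simp add: \<gamma> K_def power2_eq_square field_simps del: real_sqrt_mult_self)
    also have "\<dots> \<le> ?s * K" using s by (intro mult_left_mono) auto
    finally have "1 / real T * ?S \<le> 1 / real T * (?s * K)" by (intro mult_left_mono) auto
    also have "\<dots> = (?s * K) / (?s * ?s)" unfolding s(2) by simp
    also have "\<dots> = K / ?s" using s(1) by (simp del: real_sqrt_mult_self)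
    also have "\<dots> = K * real T powr (- 1 / 2)"
      by (simp add: powr_minus_divide powr_half_sqrt)
    finally show ?thesis using summed(1) by blast
  qed
  show "\<exists>K>0. \<exists>T0. \<exists>\<gamma>. (\<forall>T. \<gamma> T > 0) \<and>
    (\<forall>T\<ge>T0. \<forall>(M :: 'o measure) F w x \<delta> \<epsilon> occ_\<delta> occ_\<epsilon>.
       (\<forall>t \<omega>. w t \<omega> =
          psgd N out W f R w0 (\<gamma> T) (\<lambda>s. x s \<omega>) (\<lambda>s i. \<delta> s i \<omega>) (\<lambda>s i. \<epsilon> s i \<omega>) t) \<and>
       sampling_run N A D T M F w x \<delta> \<epsilon> \<and>
       zero_mean N out f T M F w x \<delta> \<epsilon> \<and>
       (AE \<omega> in M. intermittent c T {1..N} occ_\<delta> \<delta> \<omega> \<and> intermittent c T {2..N} occ_\<epsilon> \<epsilon> \<omega>) \<and>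
       (AE \<omega> in M. real (occurrences T {1..N} occ_\<delta> \<omega>) \<le> c * real T powr (1 / 2)) \<and>
       (AE \<omega> in M. real (occurrences T {2..N} occ_\<epsilon> \<omega>) \<le> c * real T)
       \<longrightarrow>
         (\<forall>t<T. integrable M (\<lambda>\<omega>. (norm (grad (expected_loss N out f R D) (w t \<omega>)))\<^sup>2)) \<and>
         1 / real T * (\<Sum>t<T. \<integral>\<omega>. (norm (grad (expected_loss N out f R D) (w t \<omega>)))\<^sup>2 \<partial>M)
           \<le> K * real T powr (- 1 / 2))"
    by (intro exI[of _ K] exI[of _ "1::nat"] exI[of _ \<gamma>] conjI allI impI K \<gamma>_pos; elim conjE)
       (use rate in blast)+
qed

end
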